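(* Let $n\ge 2$, let $\varepsilon>0$, and let $K$ and $L$ be origin-symmetric convex bodies in $\mathbb{R}^n$ such that $L$ is a projection body. If for every $\xi\in S^{n-1}$ $$|K\vert\xi^\perp|\ \le\ |L\vert\xi^\perp|-\varepsilon,$$ then $$|K|^{\frac{n-1}{n}}\ \le\ |L|^{\frac{n-1}{n}}-c_n\,\varepsilon,$$ where $c_n = |B_2^n|^{\frac{n-1}{n}}/|B_2^{n-1}|$.
   Context: A convex body in $\mathbb{R}^n$ is a compact convex set with nonempty interior; it is origin-symmetric if $K=-K$. $|\cdot|$ denotes volume (Lebesgue measure) in the appropriate dimension: for a set in $\mathbb{R}^n$ it is $n$-dimensional volume, and for a subset of a hyperplane it is $(n-1)$-dimensional volume. $B_2^m$ is the Euclidean unit ball in $\mathbb{R}^m$ and $S^{n-1}$ is the Euclidean unit sphere in $\mathbb{R}^n$. For $\xi\in S^{n-1}$, $\xi^\perp$ is the hyperplane through the origin orthogonal to $\xi$, and $K\vert\xi^\perp$ is the orthogonal projection of $K$ onto $\xi^\perp$. The support function of a convex body $K$ is $h_K(x)=\max_{y\in K}(x,y)$, $x\in\mathbb{R}^n$. For an origin-symmetric convex body $M$ in $\mathbb{R}^n$, its projection body $\Pi M$ is the origin-symmetric convex body with $h_{\Pi M}(\theta)=|M\vert\theta^\perp|$ for every $\theta\in S^{n-1}$. A convex body $L$ in $\mathbb{R}^n$ is called a projection body if $L=\Pi M$ for some such $M$. *)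

theory Defs
  imports "HOL-Analysis.Analysis"
begin

definition convex_body :: "'a::euclidean_space set \<Rightarrow> bool" where
  "convex_body K \<longleftrightarrow> compact K \<and> convex K \<and> interior K \<noteq> {}"

definition origin_symmetric :: "'a::real_vector set \<Rightarrow> bool" where
  "origin_symmetric K \<longleftrightarrow> uminus ` K = K"

definition orthonormal_basis_of :: "'a::euclidean_space set \<Rightarrow> 'a set \<Rightarrow> bool" where
  "orthonormal_basis_of S B \<longleftrightarrow>
     B \<subseteq> S \<and> span B = S \<and> pairwise orthogonal B \<and> (\<forall>b\<in>B. norm b = 1)"

lemma ex_orthonormal_basis_of:
  assumes "subspace S"
  shows "\<exists>B. orthonormal_basis_of S B"
  using orthonormal_basis_subspace[OF assms] unfolding orthonormal_basis_of_def by metis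

(* Lebesgue-Borel measure of dimension dim S on a linear subspace S, constructed as lborel is on
   the whole space, with an orthonormal basis of S in place of Basis.  Any two such bases differ
   by an isometry of S, so the measure does not depend on the chosen one. *)
definition lborel_subspace :: "'a::euclidean_space set \<Rightarrow> 'a measure" where
  "lborel_subspace S =
     (let B = (SOME B. orthonormal_basis_of S B)
      in distr (\<Pi>\<^sub>M b\<in>B. lborel) borel (\<lambda>f. \<Sum>b\<in>B. f b *\<^sub>R b))"

(* Orthogonal projection onto the hyperplane orthogonal to \<xi>; the formula presupposes norm \<xi> = 1. *)
definition proj_perp :: "'a::euclidean_space \<Rightarrow> 'a set \<Rightarrow> 'a set" where
  "proj_perp \<xi> K = (\<lambda>x. x - (x \<bullet> \<xi>) *\<^sub>R \<xi>) ` K"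

definition proj_vol :: "'a::euclidean_space set \<Rightarrow> 'a \<Rightarrow> real" where
  "proj_vol K \<xi> = measure (lborel_subspace ({\<xi>}\<^sup>\<bottom>)) (proj_perp \<xi> K)"

(* The supremum is a maximum for nonempty compact K. *)
definition support_function :: "'a::euclidean_space set \<Rightarrow> 'a \<Rightarrow> real" where
  "support_function K x = (SUP y\<in>K. x \<bullet> y)"

(* L = \<Pi> M.  A relation suffices because a convex body is determined by its support function
   on the unit sphere. *)
definition is_projection_body_of :: "'a::euclidean_space set \<Rightarrow> 'a set \<Rightarrow> bool" where
  "is_projection_body_of L M \<longleftrightarrow>
     convex_body L \<and> origin_symmetric L \<and>
     (\<forall>\<theta>\<in>sphere 0 1. support_function L \<theta> = proj_vol M \<theta>)"

definition projection_body :: "'a::euclidean_space set \<Rightarrow> bool" where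
  "projection_body L \<longleftrightarrow>
     (\<exists>M. convex_body M \<and> origin_symmetric M \<and> is_projection_body_of L M)"

(* unit_ball_vol m is the volume of the Euclidean unit ball of dimension m, see content_cball. *)
definition proj_const :: "nat \<Rightarrow> real" where
  "proj_const n =
     unit_ball_vol (real n) powr ((real n - 1) / real n) / unit_ball_vol (real n - 1)"

end

theory Submission
  imports Defs
begin

text \<open>
  Write \<open>L = \<Pi> M\<close>.  Then \<open>L\<close> is a zonoid: its support function at \<open>\<theta>\<close> is half the integral of
  \<open>\<bar>\<nabla>f \<bullet> \<theta>\<bar>\<close> up to small errors, where \<open>f\<close> is a \<open>C\<^sup>1\<close> bump that is \<open>1\<close> on \<open>M\<close> and
  vanishes off a small neighbourhood of \<open>M\<close>.  Replacing \<open>\<nabla>f\<close> by a simple function squeezes a zonotope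
  \<open>Z = \<Sum>i. [-v i, v i]\<close> between \<open>(1 - \<delta>) L\<close> and \<open>(1 + \<delta>) L\<close>.

  Adding a segment to a convex body \<open>C\<close> increases its volume by \<open>2 \<bar>v\<bar>\<close> times the projection volume
  of \<open>C\<close> along \<open>v\<close>, so \<open>2 (\<Sum>i. \<bar>v i\<bar> \<bar>C|v i\<^sup>\<bottom>\<bar>)\<close> is the derivative of \<open>\<bar>C + t Z\<bar>\<close> at
  \<open>t = 0\<close>.  By the Brunn-Minkowski inequality it is at least \<open>n \<bar>C\<bar>\<^bsup>(n-1)/n\<^esup> \<bar>Z\<bar>\<^bsup>1/n\<^esup>\<close>.  This is
  used for \<open>C = K\<close>, and for the unit ball \<open>C\<close>, where it bounds \<open>\<Sum>i. \<bar>v i\<bar>\<close> from below.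
  For \<open>C = L\<close> the derivative is at most \<open>n (1 + \<delta>) \<bar>L\<bar>\<close>.  Summing the hypothesis over the directions
  \<open>v i\<close> and letting \<open>\<delta>\<close> tend to \<open>0\<close> gives the theorem.
\<close>

section \<open>Brunn-Minkowski inequality\<close>

text \<open>The hypothesis compares K and L one direction at a time, so it can only be summed
  against a positive weight on directions. The weight that turns the sum for L into a multiple of
  |L| is the one that builds L itself out of segments, and such a weight exists because L is a
  projection body. The constant comes from the ball: its projections all have volume |B_2^(n-1)|, so
  the inequality for C the ball says that 2 |B_2^(n-1)| times the total length of the generators is
  at least n |B_2^n|^((n-1)/n) |Z|^(1/n). In the limit every term carries |L|^(1/n), and dividing by
  it leaves c_n. Concentric balls give equality. Zonotopes turn the mixed volume V(C,...,C,L) into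
  finite sums of projection volumes. The gradient field stands in for the surface area measure of M
  in Cauchy's projection formula. Smearing the boundary over a thin shell reduces the formula to
  one-dimensional integrals over lines and asks no regularity of the boundary of M.\<close>

lemma prod_one_plus_ge:
  fixes z :: "'b \<Rightarrow> real"
  assumes "finite S" "S \<noteq> {}" "\<And>i. i \<in> S \<Longrightarrow> z i > 0" "r > 0" and z: "(\<Prod>i\<in>S. z i) = r ^ card S"
  shows "(1 + r) ^ card S \<le> (\<Prod>i\<in>S. 1 + z i)"
proof -
  define N where "N = card S"
  have N: "N > 0" using assms(1,2) by (simp add: N_def card_gt_0_iff)
  define Q where "Q = (\<Prod>i\<in>S. 1 + z i)"
  have Q: "Q > 0" unfolding Q_def using assms(3) by (intro prod_pos) (simp add: add_pos_pos)
  have pos: "1 + z i > 0" if "i \<in> S" for i using assms(3)[OF that] by simp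
  \<comment> \<open>AM-GM is applied to 1 / (1 + z i) and to z i / (1 + z i). The two arithmetic
    means add up to 1, while the geometric means are Q^(-1/N) and r Q^(-1/N).\<close>
  have "(\<Prod>i\<in>S. 1 / (1 + z i)) powr (1 / N) \<le> (\<Sum>i\<in>S. 1 / (1 + z i) / N)"
    unfolding N_def by (rule arith_geom_mean) (use assms pos in \<open>auto simp: less_imp_le\<close>)
  moreover have "(\<Prod>i\<in>S. z i / (1 + z i)) powr (1 / N) \<le> (\<Sum>i\<in>S. z i / (1 + z i) / N)"
    unfolding N_def by (rule arith_geom_mean) (use assms pos in \<open>auto simp: less_imp_le\<close>)
  moreover have "(\<Sum>i\<in>S. 1 / (1 + z i) / N) + (\<Sum>i\<in>S. z i / (1 + z i) / N) = (\<Sum>i\<in>S. 1 / N)"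
    unfolding sum.distrib[symmetric]
    by (rule sum.cong) (use pos in \<open>force simp: add_divide_distrib[symmetric]\<close>)+
  moreover have "(\<Sum>i\<in>S. 1 / real N) = 1" using N by (simp add: N_def)
  moreover have "(\<Prod>i\<in>S. 1 / (1 + z i)) = 1 / Q"
    by (simp add: Q_def prod_dividef)
  moreover have "(\<Prod>i\<in>S. z i / (1 + z i)) = r ^ N / Q"
    by (simp add: Q_def prod_dividef z N_def)
  moreover have "(r ^ N / Q) powr (1 / N) = r * (1 / Q) powr (1 / N)"
    using N Q \<open>r > 0\<close> by (simp add: powr_divide powr_powr flip: powr_realpow)
  ultimately have "(1 + r) * (1 / Q) powr (1 / N) \<le> 1" by (simp add: distrib_right)
  then have "1 + r \<le> Q powr (1 / N)"
    using Q by (simp add: powr_divide field_simps)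
  then have "(1 + r) ^ N \<le> (Q powr (1 / N)) ^ N"
    using \<open>r > 0\<close> by (intro power_mono) auto
  also have "\<dots> = Q" using N Q by (simp add: powr_powr flip: powr_realpow)
  finally show ?thesis by (simp add: Q_def N_def)
qed

lemma cbox_plus_subset:
  fixes a b c d :: "'a::euclidean_space"
  shows "cbox a b \<noteq> {} \<Longrightarrow> cbox c d \<noteq> {} \<Longrightarrow> cbox (a + c) (b + d) \<subseteq> cbox a b + cbox c d"
proof
  fix x assume ne: "cbox a b \<noteq> {}" "cbox c d \<noteq> {}" and x: "x \<in> cbox (a + c) (b + d)"
  \<comment> \<open>The coordinatewise least y with a \<le> y and x - y \<le> d.\<close>
  define y where "y = (\<Sum>i\<in>Basis. max (a \<bullet> i) (x \<bullet> i - d \<bullet> i) *\<^sub>R i)"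
  have "y \<in> cbox a b" using ne x unfolding y_def mem_box box_ne_empty
    by (force simp: inner_add_left)
  moreover have "x - y \<in> cbox c d" using ne x unfolding y_def mem_box box_ne_empty
    by (fastforce simp: inner_add_left inner_diff_left)
  ultimately show "x \<in> cbox a b + cbox c d" by (metis set_plus_intro add.commute diff_add_cancel)
qed

lemma compact_set_plus:
  fixes A B :: "'a::real_normed_vector set"
  assumes "compact A" "compact B" shows "compact (A + B)"
proof -
  have "A + B = {x + y |x y. x \<in> A \<and> y \<in> B}" by (auto simp: set_plus_def)
  then show ?thesis using compact_sums[OF assms] by simp
qed

text \<open>After division by the volume of the first box this is \<open>prod_one_plus_ge\<close>
  for the ratios of side lengths.\<close>

lemma brunn_minkowski_box:
  fixes a b c d :: "'a::euclidean_space"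
  assumes "box a b \<noteq> {}" "box c d \<noteq> {}" "r > 0"
    and eq: "measure lebesgue (cbox c d) = r ^ DIM('a) * measure lebesgue (cbox a b)"
  shows "(1 + r) ^ DIM('a) * measure lebesgue (cbox a b) \<le> measure lebesgue (cbox a b + cbox c d)"
proof -
  let ?z = "\<lambda>i. (d \<bullet> i - c \<bullet> i) / (b \<bullet> i - a \<bullet> i)"
  have p: "\<And>i. i \<in> Basis \<Longrightarrow> a \<bullet> i < b \<bullet> i" "\<And>i. i \<in> Basis \<Longrightarrow> c \<bullet> i < d \<bullet> i"
    using assms by (auto simp: box_ne_empty)
  then have p': "\<forall>i\<in>Basis. a \<bullet> i \<le> b \<bullet> i" "\<forall>i\<in>Basis. c \<bullet> i \<le> d \<bullet> i" by (auto simp: less_imp_le)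
  then have ne: "cbox a b \<noteq> {}" "cbox c d \<noteq> {}" "cbox (a + c) (b + d) \<noteq> {}"
    unfolding box_ne_empty by (auto simp: inner_add_left add_mono)
  have m: "measure lebesgue (cbox u v) = (\<Prod>i\<in>Basis. v \<bullet> i - u \<bullet> i)" if "cbox u v \<noteq> {}" for u v :: 'a
    using content_cbox'[OF that] by simp
  have pos: "(\<Prod>i\<in>Basis. b \<bullet> i - a \<bullet> i) > 0" using p by (intro prod_pos) simp
  have "(1 + r) ^ DIM('a) \<le> (\<Prod>i\<in>Basis. 1 + ?z i)"
  proof (rule prod_one_plus_ge)
    show "(\<Prod>i\<in>Basis. ?z i) = r ^ DIM('a)"
      unfolding prod_dividef using eq[unfolded m[OF ne(1)] m[OF ne(2)]] pos
      by (metis less_irrefl nonzero_mult_div_cancel_right)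
  qed (use p \<open>r > 0\<close> in auto)
  also have "(\<Prod>i\<in>Basis. 1 + ?z i) = (\<Prod>i\<in>Basis. ((b + d) \<bullet> i - (a + c) \<bullet> i) / (b \<bullet> i - a \<bullet> i))"
  proof (rule prod.cong)
    fix i :: 'a assume "i \<in> Basis"
    from p(1)[OF this] show "1 + ?z i = ((b + d) \<bullet> i - (a + c) \<bullet> i) / (b \<bullet> i - a \<bullet> i)"
      by (simp add: field_simps inner_add_left)
  qed simp
  also have "\<dots> = measure lebesgue (cbox (a + c) (b + d)) / measure lebesgue (cbox a b)"
    unfolding m[OF ne(1)] m[OF ne(3)] prod_dividef ..
  finally have "(1 + r) ^ DIM('a) * measure lebesgue (cbox a b) \<le> measure lebesgue (cbox (a + c) (b + d))"
    using pos unfolding m[OF ne(1)] m[OF ne(3)] by (simp add: pos_le_divide_eq)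
  also have "\<dots> \<le> measure lebesgue (cbox a b + cbox c d)"
    by (rule measure_mono_fmeasurable)
       (use cbox_plus_subset[OF ne(1,2)] in \<open>auto intro!: lmeasurable_compact compact_set_plus compact_cbox\<close>)
  finally show ?thesis .
qed

section \<open>Cutting a set by parallel hyperplanes\<close>

lemma continuous_measure_halfspace:
  fixes B :: "'a::euclidean_space set"
  assumes "B \<in> lmeasurable" "k \<noteq> 0"
  shows "continuous_on UNIV (\<lambda>d. measure lebesgue (B \<inter> {x. x \<bullet> k \<le> d}))"
proof -
  have H [measurable]: "{x. x \<bullet> k \<le> d} \<in> sets lebesgue" for d
    using closed_halfspace_component_le by (simp add: closed_Collect_le borel_closed)
  note [measurable] = fmeasurableD[OF assms(1)]
  have "(\<lambda>n. measure lebesgue (B \<inter> {x. x \<bullet> k \<le> s n})) \<longlonglongrightarrow> measure lebesgue (B \<inter> {x. x \<bullet> k \<le> d})"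
    if s: "s \<longlonglongrightarrow> d" for s d
  proof -
    have "(\<lambda>n. LINT x|lebesgue. indicat_real (B \<inter> {x. x \<bullet> k \<le> s n}) x)
        \<longlonglongrightarrow> (LINT x|lebesgue. indicat_real (B \<inter> {x. x \<bullet> k \<le> d}) x)"
    proof (rule integral_dominated_convergence[where w="indicator B"])
      \<comment> \<open>Off this hyperplane the indicators are eventually constant along the
        sequence; on it they may fail to converge.\<close>
      have "negligible {x. k \<bullet> x = d}" using assms(2) by (simp add: negligible_hyperplane)
      then have "AE x in lebesgue. x \<notin> {x. k \<bullet> x = d}"
        using AE_not_in negligible_iff_null_sets by blast
      then show "AE x in lebesgue. (\<lambda>i. indicat_real (B \<inter> {x. x \<bullet> k \<le> s i}) x)
                   \<longlonglongrightarrow> indicat_real (B \<inter> {x. x \<bullet> k \<le> d}) x"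
      proof (eventually_elim)
        fix x assume "x \<notin> {x. k \<bullet> x = d}"
        then consider "x \<bullet> k < d" | "x \<bullet> k > d" by (force simp: inner_commute)
        then have "\<forall>\<^sub>F i in sequentially. (x \<bullet> k \<le> s i) = (x \<bullet> k \<le> d)"
        proof cases
          case 1 show ?thesis using order_tendstoD(1)[OF s 1] by eventually_elim (use 1 in auto)
        next
          case 2 show ?thesis using order_tendstoD(2)[OF s 2] by eventually_elim (use 2 in auto)
        qed
        then show "(\<lambda>i. indicat_real (B \<inter> {x. x \<bullet> k \<le> s i}) x)
                   \<longlonglongrightarrow> indicat_real (B \<inter> {x. x \<bullet> k \<le> d}) x"
          by (intro tendsto_eventually) (auto elim!: eventually_mono simp: indicator_def)
      qed
      show "integrable lebesgue (indicat_real B)" using assms(1) by (simp add: fmeasurable_def)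
    qed (measurable, auto simp: indicator_def)
    then show ?thesis by simp
  qed
  then show ?thesis by (auto simp: continuous_on_sequentially comp_def)
qed

lemma ex_halfspace_measure:
  fixes B :: "'a::euclidean_space set"
  assumes "bounded B" "B \<in> lmeasurable" "k \<noteq> 0" "0 \<le> m" "m \<le> measure lebesgue B"
  shows "\<exists>d. measure lebesgue (B \<inter> {x. x \<bullet> k \<le> d}) = m"
proof -
  obtain R where R: "\<And>x. x \<in> B \<Longrightarrow> norm x \<le> R" "R > 0" using assms(1) bounded_pos by blast
  \<comment> \<open>The added 1 makes the bounds on \<open>x \<bullet> k\<close> strict, so that the
    halfspace at -R' misses B entirely.\<close>
  define R' where "R' = R * norm k + 1"
  have R': "- R' < x \<bullet> k \<and> x \<bullet> k < R'" if "x \<in> B" for x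
  proof -
    have "\<bar>x \<bullet> k\<bar> \<le> norm x * norm k" by (rule Cauchy_Schwarz_ineq2)
    also have "\<dots> \<le> R * norm k" using R(1)[OF that] by (intro mult_right_mono) auto
    finally show ?thesis by (auto simp: R'_def)
  qed
  have "B \<inter> {x. x \<bullet> k \<le> - R'} = {}" "B \<inter> {x. x \<bullet> k \<le> R'} = B" using R' by fastforce+
  moreover have "- R' \<le> R'" using R(2) by (simp add: R'_def)
  ultimately show ?thesis
    using IVT'[of "\<lambda>d. measure lebesgue (B \<inter> {x. x \<bullet> k \<le> d})" "- R'" m R'] assms
      continuous_on_subset[OF continuous_measure_halfspace[OF assms(2,3)]] by auto
qed

lemma measure_split_halfspace:
  fixes A :: "'a::euclidean_space set"
  assumes "A \<in> lmeasurable" "k \<noteq> 0"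
  shows "measure lebesgue (A \<inter> {x. x \<bullet> k \<le> c}) + measure lebesgue (A \<inter> {x. x \<bullet> k \<ge> c}) = measure lebesgue A"
proof -
  have [measurable]: "{x. x \<bullet> k \<le> c} \<in> sets lebesgue" "{x. x \<bullet> k \<ge> c} \<in> sets lebesgue"
    by (auto intro!: borel_closed closed_Collect_le continuous_intros)
  have A: "A = (A \<inter> {x. x \<bullet> k \<le> c}) \<union> (A \<inter> {x. x \<bullet> k \<ge> c})" by auto
  have "negligible {x. k \<bullet> x = c}" using assms(2) by (simp add: negligible_hyperplane)
  then have "negligible (A \<inter> {x. x \<bullet> k \<le> c} \<inter> (A \<inter> {x. x \<bullet> k \<ge> c}))"
    by (rule negligible_subset) (auto simp: inner_commute)
  moreover have "A \<inter> {x. x \<bullet> k \<le> c} \<in> lmeasurable" "A \<inter> {x. x \<bullet> k \<ge> c} \<in> lmeasurable"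
    using assms(1) by (auto intro!: fmeasurable_Int_fmeasurable)
  ultimately show ?thesis
    by (subst (3) A, subst measure_Un3) (auto simp: negligible_imp_measure0)
qed

section \<open>Brunn-Minkowski for finite unions of boxes\<close>

definition box_system :: "'a::euclidean_space set set \<Rightarrow> bool" where
  "box_system p \<longleftrightarrow> finite p \<and> (\<forall>K\<in>p. \<exists>a b. K = cbox a b) \<and>
     (\<forall>K1\<in>p. \<forall>K2\<in>p. K1 \<noteq> K2 \<longrightarrow> interior K1 \<inter> interior K2 = {})"

text \<open>The induction measure. Cutting by a halfspace leaves empty and flat boxes behind; a
  \<open>box_system\<close> admits them, and they are not counted because they carry no
  volume.\<close>

definition proper_count :: "'a::euclidean_space set set \<Rightarrow> nat" where
  "proper_count p = card {K\<in>p. interior K \<noteq> {}}"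

lemma box_system_compact: "box_system p \<Longrightarrow> compact (\<Union>p)"
  unfolding box_system_def by (intro compact_Union) auto

lemma measure_box_system:
  assumes "box_system p"
  shows "measure lebesgue (\<Union>p) = measure lebesgue (\<Union>{K\<in>p. interior K \<noteq> {}})"
proof (rule measure_negligible_symdiff[symmetric])
  show "\<Union>p \<in> lmeasurable" using box_system_compact[OF assms] by (rule lmeasurable_compact)
  have "negligible (\<Union>{K\<in>p. interior K = {}})"
    using assms unfolding box_system_def
    by (intro negligible_Union) (auto simp: negligible_convex_interior)
  then show "negligible (sym_diff (\<Union>p) (\<Union>{K\<in>p. interior K \<noteq> {}}))"
    by (rule negligible_subset) auto
qed

text \<open>Distinct pieces come from distinct boxes, so interiors stay disjoint. A piece with
  interior comes from a box with interior, so the count cannot grow, and it drops as soon as one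
  such box loses its interior.\<close>

lemma box_system_split:
  assumes p: "box_system p" and k: "k \<in> Basis" and H: "H = {x. x \<bullet> k \<le> c} \<or> H = {x. x \<bullet> k \<ge> c}"
  shows "box_system ((\<lambda>K. K \<inter> H) ` p)"
    and "\<Union>((\<lambda>K. K \<inter> H) ` p) = \<Union>p \<inter> H"
    and "K2 \<in> p \<Longrightarrow> interior K2 \<noteq> {} \<Longrightarrow> interior (K2 \<inter> H) = {} \<Longrightarrow> proper_count ((\<lambda>K. K \<inter> H) ` p) < proper_count p"
    and "proper_count ((\<lambda>K. K \<inter> H) ` p) \<le> proper_count p"
proof -
  have fin: "finite p" using p by (simp add: box_system_def)
  show "box_system ((\<lambda>K. K \<inter> H) ` p)"
    unfolding box_system_def
  proof (intro conjI ballI impI)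
    show "finite ((\<lambda>K. K \<inter> H) ` p)" using fin by simp
  next
    fix K assume "K \<in> (\<lambda>K. K \<inter> H) ` p"
    then obtain a b where "K = cbox a b \<inter> H" using p by (auto simp: box_system_def)
    then show "\<exists>a b. K = cbox a b" using H interval_split[OF k, of a b c] by auto
  next
    fix K1 K2 assume "K1 \<in> (\<lambda>K. K \<inter> H) ` p" "K2 \<in> (\<lambda>K. K \<inter> H) ` p" "K1 \<noteq> K2"
    then obtain L1 L2 where "L1 \<in> p" "L2 \<in> p" "L1 \<noteq> L2" "K1 \<subseteq> L1" "K2 \<subseteq> L2" by auto
    then show "interior K1 \<inter> interior K2 = {}"
      using p interior_mono unfolding box_system_def by (metis (no_types, lifting) inf_mono subset_empty)
  qed
  show "\<Union>((\<lambda>K. K \<inter> H) ` p) = \<Union>p \<inter> H" by auto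
  let ?P = "{K\<in>p. interior K \<noteq> {}}" and ?Q = "{K\<in>(\<lambda>K. K \<inter> H) ` p. interior K \<noteq> {}}"
  have sub: "?Q \<subseteq> (\<lambda>K. K \<inter> H) ` ?P" using interior_mono[of "_ \<inter> H"] by auto
  then show "proper_count ((\<lambda>K. K \<inter> H) ` p) \<le> proper_count p"
    unfolding proper_count_def using fin by (intro surj_card_le) auto
  assume K2: "K2 \<in> p" "interior K2 \<noteq> {}" "interior (K2 \<inter> H) = {}"
  have "?Q \<subseteq> (\<lambda>K. K \<inter> H) ` (?P - {K2})" using sub K2 by auto
  then have "card ?Q \<le> card (?P - {K2})"
    using fin by (intro surj_card_le) auto
  also have "\<dots> < card ?P" using fin K2 by (intro psubset_card_mono) auto
  finally show "proper_count ((\<lambda>K. K \<inter> H) ` p) < proper_count p"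
    unfolding proper_count_def .
qed

lemma box_system_separate:
  assumes "box_system p" "proper_count p \<ge> 2"
  obtains k c K1 K2 where "k \<in> Basis" "K1 \<in> p" "K2 \<in> p" "interior K1 \<noteq> {}" "interior K2 \<noteq> {}"
    "K1 \<subseteq> {x. x \<bullet> k \<le> c}" "K2 \<subseteq> {x. x \<bullet> k \<ge> c}"
proof -
  obtain K1 K2 where K: "K1 \<in> p" "K2 \<in> p" "interior K1 \<noteq> {}" "interior K2 \<noteq> {}" "K1 \<noteq> K2"
  proof -
    have "finite {K\<in>p. interior K \<noteq> {}}" using assms(1) by (simp add: box_system_def)
    then show thesis
      using that assms(2) card_le_Suc0_iff_eq[of "{K\<in>p. interior K \<noteq> {}}"]
      unfolding proper_count_def by auto
  qed
  then obtain a b c d where ab: "K1 = cbox a b" "K2 = cbox c d" using assms(1) unfolding box_system_def by metis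
  have ne: "box a b \<noteq> {}" "box c d \<noteq> {}" using K ab by auto
  have "interior K1 \<inter> interior K2 = {}" using assms(1) K unfolding box_system_def by blast
  then have "box a b \<inter> box c d = {}" by (simp add: ab)
  then obtain i where i: "i \<in> Basis" "b \<bullet> i \<le> a \<bullet> i \<or> d \<bullet> i \<le> c \<bullet> i \<or> b \<bullet> i \<le> c \<bullet> i \<or> d \<bullet> i \<le> a \<bullet> i"
    unfolding disjoint_interval by blast
  \<comment> \<open>The first two alternatives would make one of the open boxes empty.\<close>
  then have "b \<bullet> i \<le> c \<bullet> i \<or> d \<bullet> i \<le> a \<bullet> i" using ne unfolding box_ne_empty by (meson not_le)
  then show thesis
  proof
    assume "b \<bullet> i \<le> c \<bullet> i"
    then show thesis using i(1) K ab by (intro that[of i K1 K2 "b \<bullet> i"]) (force simp: mem_box)+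
  next
    assume "d \<bullet> i \<le> a \<bullet> i"
    then show thesis using i(1) K ab by (intro that[of i K2 K1 "d \<bullet> i"]) (force simp: mem_box)+
  qed
qed

lemma interior_halfspace_Int_empty:
  fixes k :: "'a::euclidean_space"
  assumes "k \<noteq> 0" "K \<subseteq> {x. x \<bullet> k \<ge> c}"
  shows "interior (K \<inter> {x. x \<bullet> k \<le> c}) = {}"
proof -
  have "K \<inter> {x. x \<bullet> k \<le> c} \<subseteq> {x. k \<bullet> x = c}" using assms(2) by (force simp: inner_commute)
  then show ?thesis using interior_mono interior_hyperplane[OF assms(1)] by blast
qed

text \<open>
  The Hadwiger-Ohmann argument: a coordinate hyperplane separating two boxes of \<open>p\<close> cuts \<open>\<Union>p\<close>, and a
  parallel one cuts \<open>\<Union>q\<close> in the same volume ratio.  The sums of corresponding halves lie on opposite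
  sides of a third parallel hyperplane, so their volumes add up.
\<close>

lemma brunn_minkowski_boxes_step:
  fixes p q :: "'a::euclidean_space set set"
  assumes IH: "\<And>(p'::'a set set) q'. proper_count p' + proper_count q' < proper_count p + proper_count q \<Longrightarrow>
      box_system p' \<Longrightarrow> box_system q' \<Longrightarrow>
      measure lebesgue (\<Union>q') = r ^ DIM('a) * measure lebesgue (\<Union>p') \<Longrightarrow>
      measure lebesgue (\<Union>p') > 0 \<Longrightarrow>
      (1 + r) ^ DIM('a) * measure lebesgue (\<Union>p') \<le> measure lebesgue (\<Union>p' + \<Union>q')"
    and p: "box_system p" and q: "box_system q" and r: "r > 0"
    and eq: "measure lebesgue (\<Union>q) = r ^ DIM('a) * measure lebesgue (\<Union>p)"
    and two: "proper_count p \<ge> 2"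
  shows "(1 + r) ^ DIM('a) * measure lebesgue (\<Union>p) \<le> measure lebesgue (\<Union>p + \<Union>q)"
proof -
  from box_system_separate[OF p two] obtain k c K1 K2 where K: "k \<in> Basis" "K1 \<in> p" "K2 \<in> p"
    "interior K1 \<noteq> {}" "interior K2 \<noteq> {}" "K1 \<subseteq> {x. x \<bullet> k \<le> c}" "K2 \<subseteq> {x. x \<bullet> k \<ge> c}" .
  have k0: "k \<noteq> 0" using K(1) by auto
  let ?A = "\<Union>p" and ?B = "\<Union>q"
  let ?lo = "\<lambda>c. {x::'a. x \<bullet> k \<le> c}" and ?hi = "\<lambda>c. {x::'a. x \<bullet> k \<ge> c}"
  have Am: "?A \<in> lmeasurable" and Bm: "?B \<in> lmeasurable"
    using box_system_compact p q lmeasurable_compact by blast+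
  have hs: "closed (?lo c)" "closed (?hi c)" for c
    by (auto intro!: closed_Collect_le continuous_intros)
  have cpt: "compact (?A \<inter> ?lo c)" "compact (?A \<inter> ?hi c)" "compact (?B \<inter> ?lo c)" "compact (?B \<inter> ?hi c)" for c
    using box_system_compact p q hs by (auto intro: compact_Int_closed)
  have sA: "measure lebesgue (?A \<inter> ?lo c) + measure lebesgue (?A \<inter> ?hi c) = measure lebesgue ?A"
    by (rule measure_split_halfspace[OF Am k0])
  have pos: "measure lebesgue K > 0" if "K \<in> p" "interior K \<noteq> {}" for K
    using that p unfolding box_system_def
    by (metis content_eq_0_interior measure_nonneg le_less measure_completion cbox_borel sets_lborel)
  have "measure lebesgue K1 \<le> measure lebesgue (?A \<inter> ?lo c)"
    using K cpt p by (intro measure_mono_fmeasurable) (auto simp: lmeasurable_compact box_system_def)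
  then have Alo: "measure lebesgue (?A \<inter> ?lo c) > 0" using pos[OF K(2,4)] by linarith
  have "measure lebesgue K2 \<le> measure lebesgue (?A \<inter> ?hi c)"
    using K cpt p by (intro measure_mono_fmeasurable) (auto simp: lmeasurable_compact box_system_def)
  then have Ahi: "measure lebesgue (?A \<inter> ?hi c) > 0" using pos[OF K(3,5)] by linarith
  \<comment> \<open>Both pairs of halves must have the ratio r of the whole sets for the induction
    hypothesis to apply. The level d is chosen for the lower halves; the upper ones follow by
    subtraction.\<close>
  have "\<exists>d. measure lebesgue (?B \<inter> ?lo d) = r ^ DIM('a) * measure lebesgue (?A \<inter> ?lo c)"
  proof (rule ex_halfspace_measure)
    show "r ^ DIM('a) * measure lebesgue (?A \<inter> ?lo c) \<le> measure lebesgue ?B"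
      unfolding eq using r sA Ahi by (intro mult_left_mono) auto
  qed (use Bm k0 r box_system_compact[OF q] in \<open>auto intro: compact_imp_bounded\<close>)
  then obtain d where d: "measure lebesgue (?B \<inter> ?lo d) = r ^ DIM('a) * measure lebesgue (?A \<inter> ?lo c)" ..
  have "measure lebesgue (?B \<inter> ?lo d) + measure lebesgue (?B \<inter> ?hi d) = measure lebesgue ?B"
    by (rule measure_split_halfspace[OF Bm k0])
  then have d': "measure lebesgue (?B \<inter> ?hi d) = r ^ DIM('a) * measure lebesgue (?A \<inter> ?hi c)"
    using d eq sA by (simp add: algebra_simps flip: sA)
  \<comment> \<open>Each half of p loses one of the two separated boxes, while the cut of q does not
    increase its count, so the total count decreases.\<close>
  have "interior (K2 \<inter> ?lo c) = {}"
    by (rule interior_halfspace_Int_empty[OF k0 K(7)])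
  then have lo: "proper_count ((\<lambda>K. K \<inter> ?lo c) ` p) < proper_count p"
    using box_system_split(3)[OF p K(1)] K by blast
  have "interior (K1 \<inter> ?hi c) = {}"
    using interior_halfspace_Int_empty[of "- k" K1 "- c"] k0 K(6) by simp
  then have hi: "proper_count ((\<lambda>K. K \<inter> ?hi c) ` p) < proper_count p"
    using box_system_split(3)[OF p K(1)] K by blast
  have 1: "(1 + r) ^ DIM('a) * measure lebesgue (?A \<inter> ?lo c) \<le> measure lebesgue (?A \<inter> ?lo c + ?B \<inter> ?lo d)"
    using IH[of "(\<lambda>K. K \<inter> ?lo c) ` p" "(\<lambda>K. K \<inter> ?lo d) ` q",
        OF add_less_le_mono[OF lo box_system_split(4)[OF q K(1) disjI1[OF refl]]]
          box_system_split(1)[OF p K(1) disjI1[OF refl]] box_system_split(1)[OF q K(1) disjI1[OF refl]]] d Alo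
    unfolding box_system_split(2)[OF p K(1) disjI1[OF refl]] box_system_split(2)[OF q K(1) disjI1[OF refl]]
    by blast
  have 2: "(1 + r) ^ DIM('a) * measure lebesgue (?A \<inter> ?hi c) \<le> measure lebesgue (?A \<inter> ?hi c + ?B \<inter> ?hi d)"
    using IH[of "(\<lambda>K. K \<inter> ?hi c) ` p" "(\<lambda>K. K \<inter> ?hi d) ` q",
        OF add_less_le_mono[OF hi box_system_split(4)[OF q K(1) disjI2[OF refl]]]
          box_system_split(1)[OF p K(1) disjI2[OF refl]] box_system_split(1)[OF q K(1) disjI2[OF refl]]] d' Ahi
    unfolding box_system_split(2)[OF p K(1) disjI2[OF refl]] box_system_split(2)[OF q K(1) disjI2[OF refl]]
    by blast
  let ?S = "?A + ?B"
  have cS: "compact ?S" using box_system_compact p q compact_set_plus by blast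
  have meas_le: "measure lebesgue X \<le> measure lebesgue Y" if "compact X" "compact Y" "X \<subseteq> Y" for X Y :: "'a set"
    using that by (intro measure_mono_fmeasurable) (auto intro: lmeasurable_compact fmeasurableD)
  have "measure lebesgue (?A \<inter> ?lo c + ?B \<inter> ?lo d) \<le> measure lebesgue (?S \<inter> ?lo (c + d))"
    by (rule meas_le, intro compact_set_plus cpt, intro compact_Int_closed cS hs)
       (auto simp: inner_add_left intro!: add_mono elim!: set_plus_elim)
  moreover have "measure lebesgue (?A \<inter> ?hi c + ?B \<inter> ?hi d) \<le> measure lebesgue (?S \<inter> ?hi (c + d))"
    by (rule meas_le, intro compact_set_plus cpt, intro compact_Int_closed cS hs)
       (auto simp: inner_add_left intro!: add_mono elim!: set_plus_elim)
  moreover have "measure lebesgue (?S \<inter> ?lo (c + d)) + measure lebesgue (?S \<inter> ?hi (c + d)) = measure lebesgue ?S"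
    by (rule measure_split_halfspace[OF lmeasurable_compact[OF cS] k0])
  ultimately have "(1 + r) ^ DIM('a) * (measure lebesgue (?A \<inter> ?lo c) + measure lebesgue (?A \<inter> ?hi c))
      \<le> measure lebesgue ?S"
    using 1 2 by (simp add: distrib_left)
  then show ?thesis unfolding sA .
qed

text \<open>If p has at most one proper box, q is cut instead, with the roles exchanged and ratio
  1/r; this is why r is generalized in the induction. In the base case positive volume forces
  exactly one proper box on each side.\<close>

lemma brunn_minkowski_boxes:
  fixes p q :: "'a::euclidean_space set set"
  assumes "box_system p" "box_system q" "r > 0"
    "measure lebesgue (\<Union>q) = r ^ DIM('a) * measure lebesgue (\<Union>p)" "measure lebesgue (\<Union>p) > 0"
  shows "(1 + r) ^ DIM('a) * measure lebesgue (\<Union>p) \<le> measure lebesgue (\<Union>p + \<Union>q)"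
  using assms
proof (induction "proper_count p + proper_count q" arbitrary: p q r rule: less_induct)
  case less
  have qpos: "measure lebesgue (\<Union>q) > 0" using less.prems by simp
  show ?case
  proof (cases "proper_count p \<ge> 2")
    case True
    show ?thesis
      by (rule brunn_minkowski_boxes_step[OF _ less.prems(1-4) True]) (use less in blast)
  next
    case p1: False
    show ?thesis
    proof (cases "proper_count q \<ge> 2")
      case True
      have eq: "measure lebesgue (\<Union>p) = (1 / r) ^ DIM('a) * measure lebesgue (\<Union>q)"
        using less.prems by (simp add: power_one_over)
      have "(1 + 1 / r) ^ DIM('a) * measure lebesgue (\<Union>q) \<le> measure lebesgue (\<Union>q + \<Union>p)"
      proof (rule brunn_minkowski_boxes_step[OF less.hyps less.prems(2,1) _ eq True])
        fix p' q' :: "'a set set"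
        assume "proper_count p' + proper_count q' < proper_count q + proper_count p"
        then show "proper_count p' + proper_count q' < proper_count p + proper_count q"
          by (simp only: add.commute)
      qed (use less.prems(3) in simp_all)
      also have "(1 + 1 / r) ^ DIM('a) * measure lebesgue (\<Union>q) = (1 + r) ^ DIM('a) * measure lebesgue (\<Union>p)"
      proof -
        have "(1 + 1 / r) * r = 1 + r" using less.prems(3) by (simp add: field_simps)
        then show ?thesis
          unfolding less.prems(4) mult.assoc[symmetric] power_mult_distrib[symmetric] by simp
      qed
      finally show ?thesis by (simp add: add.commute)
    next
      case q1: False
      have one: "\<exists>a b. box a b \<noteq> {} \<and> cbox a b \<in> p \<and> measure lebesgue (\<Union>p) = measure lebesgue (cbox a b)"
        if p: "box_system p" "\<not> 2 \<le> proper_count p" "measure lebesgue (\<Union>p) > 0" for p :: "'a set set"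
      proof -
        have fin: "finite {K\<in>p. interior K \<noteq> {}}" using p(1) by (simp add: box_system_def)
        have "{K\<in>p. interior K \<noteq> {}} \<noteq> {}"
          using p(3) unfolding measure_box_system[OF p(1)] by (metis Union_empty less_irrefl measure_empty)
        then have "card {K\<in>p. interior K \<noteq> {}} = 1"
          using p(2) fin card_0_eq[OF fin] unfolding proper_count_def by linarith
        then obtain K where K: "{K\<in>p. interior K \<noteq> {}} = {K}" by (auto simp: card_1_singleton_iff)
        then have "K \<in> p" "interior K \<noteq> {}" by auto
        then obtain a b where "K = cbox a b" using p(1) unfolding box_system_def by metis
        then show ?thesis using K \<open>K \<in> p\<close> \<open>interior K \<noteq> {}\<close>
          unfolding measure_box_system[OF p(1)] K by auto
      qed
      obtain a b where ab: "box a b \<noteq> {}" "cbox a b \<in> p" "measure lebesgue (\<Union>p) = measure lebesgue (cbox a b)"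
        using one[OF less.prems(1) p1 less.prems(5)] by blast
      obtain c d where cd: "box c d \<noteq> {}" "cbox c d \<in> q" "measure lebesgue (\<Union>q) = measure lebesgue (cbox c d)"
        using one[OF less.prems(2) q1 qpos] by blast
      have "(1 + r) ^ DIM('a) * measure lebesgue (\<Union>p) \<le> measure lebesgue (cbox a b + cbox c d)"
        unfolding ab(3) by (rule brunn_minkowski_box) (use less.prems ab cd in auto)
      also have "\<dots> \<le> measure lebesgue (\<Union>p + \<Union>q)"
        using ab(2) cd(2) less.prems(1,2)
        by (intro measure_mono_fmeasurable set_plus_mono2)
           (auto intro!: lmeasurable_compact compact_set_plus box_system_compact fmeasurableD)
      finally show ?thesis .
    qed
  qed
qed

lemma ex_box_system_approx:
  fixes A :: "'a::euclidean_space set"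
  assumes "open A" "bounded A" "A \<noteq> {}"
  obtains p where "\<And>k. box_system (p k)" "\<And>k::nat. \<Union>(p k) \<subseteq> A"
    "(\<lambda>k. measure lebesgue (\<Union>(p k))) \<longlonglongrightarrow> measure lebesgue A"
proof -
  obtain D where D: "countable D" "D \<subseteq> Pow A" "\<And>X. X \<in> D \<Longrightarrow> \<exists>a b. X = cbox a b" "\<Union>D = A"
    using open_countable_Union_open_cbox[OF assms(1)] by metis
  have "D \<noteq> {}" using D(4) assms(3) by auto
  then have rD: "range (from_nat_into D) = D" using D(1) by (rule range_from_nat_into)
  define C where "C k = (\<Union>i<k. from_nat_into D i)" for k :: nat
  \<comment> \<open>The first k boxes of the cover may overlap; their union is divided anew into
    boxes with disjoint interiors.\<close>
  have "\<exists>p. p division_of C k" for k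
    unfolding C_def by (rule elementary_unions_intervals[of "from_nat_into D ` {..<k}"]) (use D(3) rD in blast)+
  then obtain p where p: "\<And>k. p k division_of C k" by metis
  have b: "box_system (p k)" for k
    using division_ofD[OF p[of k]] unfolding box_system_def by blast
  have U: "\<Union>(p k) = C k" for k using p by blast
  have CA: "C k \<subseteq> A" for k using D(2) rD unfolding C_def by blast
  have "(\<lambda>k. measure lebesgue (C k)) \<longlonglongrightarrow> measure lebesgue (\<Union>k. C k)"
  proof (rule Lim_measure_incseq)
    show "range C \<subseteq> sets lebesgue"
      using box_system_compact[OF b] lmeasurable_compact fmeasurableD unfolding U by blast
    show "incseq C" unfolding C_def by (auto simp: incseq_def) (meson lessThan_iff order_less_le_trans)
    have Cs: "(\<Union>k. C k) \<subseteq> A" using CA by blast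
    have "emeasure lebesgue (\<Union>k. C k) \<le> emeasure lebesgue A"
      by (rule emeasure_mono[OF Cs]) (use assms in auto)
    also have "\<dots> < \<infinity>" using lmeasurable_open[OF assms(2,1)] unfolding fmeasurable_def by blast
    finally show "emeasure lebesgue (\<Union>k. C k) \<noteq> \<infinity>" by simp
  qed
  moreover have "(\<Union>k. C k) = A"
  proof
    show "A \<subseteq> (\<Union>k. C k)"
    proof
      fix x assume "x \<in> A"
      then obtain i where "x \<in> from_nat_into D i" using D(4) rD by (metis UN_E UnionE rangeE)
      then have "x \<in> C (Suc i)" by (auto simp: C_def)
      then show "x \<in> (\<Union>k. C k)" by blast
    qed
  qed (use CA in blast)
  ultimately show thesis using that[OF b] CA unfolding U by simp
qed

text \<open>The set S allows the interiors of two bodies to be compared directly with the sum of the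
  closed bodies.\<close>

lemma brunn_minkowski_open:
  fixes A B :: "'a::euclidean_space set"
  assumes A: "open A" "bounded A" "A \<noteq> {}" and B: "open B" "bounded B" "B \<noteq> {}"
    and r: "r > 0" and eq: "measure lebesgue B = r ^ DIM('a) * measure lebesgue A"
    and S: "A + B \<subseteq> S" "S \<in> lmeasurable"
  shows "(1 + r) ^ DIM('a) * measure lebesgue A \<le> measure lebesgue S"
proof -
  have Apos: "measure lebesgue A > 0"
    using A lmeasurable_open[OF A(2,1)] open_not_negligible[OF A(1,3)]
    by (metis measure_nonneg less_eq_real_def negligible_iff_measure)
  then have Bpos: "measure lebesgue B > 0" using eq r by simp
  obtain p where p: "\<And>k. box_system (p k)" "\<And>k::nat. \<Union>(p k) \<subseteq> A"
    "(\<lambda>k. measure lebesgue (\<Union>(p k))) \<longlonglongrightarrow> measure lebesgue A" using ex_box_system_approx[OF A] by metis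
  obtain q where q: "\<And>k. box_system (q k)" "\<And>k::nat. \<Union>(q k) \<subseteq> B"
    "(\<lambda>k. measure lebesgue (\<Union>(q k))) \<longlonglongrightarrow> measure lebesgue B" using ex_box_system_approx[OF B] by metis
  \<comment> \<open>The box systems have volume ratio r^n only in the limit, so each k is given its
    own ratio, which tends to r.\<close>
  define s where "s k = root DIM('a) (measure lebesgue (\<Union>(q k)) / measure lebesgue (\<Union>(p k)))" for k
  have "s \<longlonglongrightarrow> root DIM('a) (measure lebesgue B / measure lebesgue A)"
    unfolding s_def using Apos p(3) q(3) by (intro tendsto_real_root tendsto_divide) auto
  also have "root DIM('a) (measure lebesgue B / measure lebesgue A) = r"
    using eq Apos r by (simp add: real_root_power_cancel)
  finally have s: "s \<longlonglongrightarrow> r" .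
  have "(\<lambda>k. (1 + s k) ^ DIM('a) * measure lebesgue (\<Union>(p k))) \<longlonglongrightarrow> (1 + r) ^ DIM('a) * measure lebesgue A"
    by (intro tendsto_intros s p)
  moreover have "\<forall>\<^sub>F k in sequentially. (1 + s k) ^ DIM('a) * measure lebesgue (\<Union>(p k)) \<le> measure lebesgue S"
    using order_tendstoD(1)[OF p(3) Apos] order_tendstoD(1)[OF q(3) Bpos]
  proof eventually_elim
    case (elim k)
    then have "(1 + s k) ^ DIM('a) * measure lebesgue (\<Union>(p k)) \<le> measure lebesgue (\<Union>(p k) + \<Union>(q k))"
      by (intro brunn_minkowski_boxes p q) (auto simp: s_def real_root_gt_zero)
    also have "\<dots> \<le> measure lebesgue S"
    proof (rule measure_mono_fmeasurable)
      show "\<Union>(p k) + \<Union>(q k) \<subseteq> S" using set_plus_mono2[OF p(2)[of k] q(2)[of k]] S(1) by simp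
    qed (use S in \<open>auto intro!: fmeasurableD lmeasurable_compact compact_set_plus box_system_compact p q\<close>)
    finally show ?case .
  qed
  ultimately show ?thesis by (rule tendsto_upperbound) simp
qed

lemma measure_interior_convex:
  assumes "convex K" "bounded K"
  shows "measure lebesgue (interior K) = measure lebesgue K"
proof (rule measure_negligible_symdiff[symmetric])
  show "negligible (sym_diff (interior K) K)"
  proof (rule negligible_subset[OF negligible_convex_frontier[OF assms(1)]])
    show "sym_diff (interior K) K \<subseteq> frontier K"
      using interior_subset[of K] closure_subset[of K] unfolding frontier_def by blast
  qed
qed (use assms in \<open>auto intro!: lmeasurable_open bounded_interior\<close>)

text \<open>With r = (|B|/|A|)^(1/n) this is the n-th power of |A|^(1/n) + |B|^(1/n) \<le> |A +
  B|^(1/n). The form without roots is additive over pieces with a common ratio r, as the cutting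
  argument requires.\<close>

lemma brunn_minkowski:
  fixes A B :: "'a::euclidean_space set"
  assumes A: "convex_body A" and B: "convex_body B"
    and r: "r > 0" and eq: "measure lebesgue B = r ^ DIM('a) * measure lebesgue A"
  shows "(1 + r) ^ DIM('a) * measure lebesgue A \<le> measure lebesgue (A + B)"
proof -
  have b: "bounded A" "bounded B" "convex A" "convex B"
    using A B by (auto simp: convex_body_def compact_imp_bounded)
  have "(1 + r) ^ DIM('a) * measure lebesgue (interior A) \<le> measure lebesgue (A + B)"
  proof (rule brunn_minkowski_open)
    show "interior A + interior B \<subseteq> A + B" by (intro set_plus_mono2 interior_subset)
    show "measure lebesgue (interior B) = r ^ DIM('a) * measure lebesgue (interior A)"
      unfolding measure_interior_convex[OF b(3,1)] measure_interior_convex[OF b(4,2)] by (rule eq)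
    show "A + B \<in> lmeasurable"
      using A B by (intro lmeasurable_compact compact_set_plus) (auto simp: convex_body_def)
  qed (use A B r b in \<open>auto simp: convex_body_def intro!: bounded_interior\<close>)
  then show ?thesis unfolding measure_interior_convex[OF b(3,1)] .
qed

section \<open>Integration over lines orthogonal to a hyperplane\<close>

text \<open>
  Both products \<open>M A * lborel B\<close> and \<open>M B * lborel A\<close> with \<open>B\<close> the unit ball are the same double
  integral, because \<open>B = -B\<close>.
\<close>

lemma translation_invariant_unique:
  fixes M :: "'a::euclidean_space measure"
  assumes sets: "sets M = sets borel"
    and inv: "\<And>v. distr M borel (\<lambda>x. v + x) = M"
    and ball: "emeasure M (cball 0 1) = emeasure lborel (cball 0 (1::real) :: 'a set)"
    and sf: "sigma_finite_measure M"
  shows "M = lborel"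
proof (rule measure_eqI)
  show "sets M = sets lborel" using sets by simp
  fix A assume "A \<in> sets M"
  then have A: "A \<in> sets borel" using sets by simp
  let ?B = "cball 0 1 :: 'a set"
  interpret M: sigma_finite_measure M by (rule sf)
  interpret P: pair_sigma_finite M lborel ..
  note [measurable_cong] = sets
  have invL: "distr lborel borel (\<lambda>x. v + x) = (lborel :: 'a measure)" for v
    using lborel_affine[of 1 v] by (simp add: density_1)
  have tr: "(\<integral>\<^sup>+x. f x \<partial>N) = (\<integral>\<^sup>+x. f (v + x) \<partial>N)"
    if "distr N borel (\<lambda>x. v + x) = N" "sets N = sets borel" "f \<in> borel_measurable borel" for N f and v :: 'a
    by (subst that(1)[symmetric], subst nn_integral_distr) (use that in \<open>simp_all cong: measurable_cong_sets\<close>)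
  note [measurable] = A borel_closed[OF closed_cball]
  have prod: "(\<integral>\<^sup>+x. \<integral>\<^sup>+y. indicator C x * indicator D y \<partial>N2 \<partial>N1) = emeasure N1 C * emeasure N2 D"
    if "C \<in> sets N1" "D \<in> sets N2" for C D :: "'a set" and N1 N2
  proof -
    have "(\<integral>\<^sup>+x. \<integral>\<^sup>+y. indicator C x * indicator D y \<partial>N2 \<partial>N1) = (\<integral>\<^sup>+x. indicator C x * emeasure N2 D \<partial>N1)"
      by (intro nn_integral_cong, subst nn_integral_cmult) (use that in auto)
    also have "\<dots> = emeasure N1 C * emeasure N2 D"
      by (subst nn_integral_multc) (use that in auto)
    finally show ?thesis .
  qed
  have "emeasure M A * emeasure lborel ?B = (\<integral>\<^sup>+x. \<integral>\<^sup>+y. indicator A x * indicator ?B y \<partial>lborel \<partial>M)"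
    using A by (subst prod) (auto simp: sets)
  \<comment> \<open>Invariance of \<open>lborel\<close> moves y by -x; after Fubini, invariance of M
    moves x by y. The shift thereby passes from the ball to A.\<close>
  also have "\<dots> = (\<integral>\<^sup>+x. \<integral>\<^sup>+y. indicator A x * indicator ?B (- x + y) \<partial>lborel \<partial>M)"
    by (rule nn_integral_cong, rule tr[OF invL], simp, measurable)
  also have "\<dots> = (\<integral>\<^sup>+y. \<integral>\<^sup>+x. indicator A x * indicator ?B (- x + y) \<partial>M \<partial>lborel)"
    by (subst P.Fubini') (auto simp: sets cong: measurable_cong_sets)
  also have "\<dots> = (\<integral>\<^sup>+y. \<integral>\<^sup>+x. indicator A (y + x) * indicator ?B (- (y + x) + y) \<partial>M \<partial>lborel)"
    by (rule nn_integral_cong, rule tr[OF inv sets], measurable)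
  also have "\<dots> = (\<integral>\<^sup>+y. \<integral>\<^sup>+x. indicator A (y + x) * indicator ?B x \<partial>M \<partial>lborel)"
    by (intro nn_integral_cong) (auto simp: indicator_def)
  also have "\<dots> = (\<integral>\<^sup>+x. \<integral>\<^sup>+y. indicator A (y + x) * indicator ?B x \<partial>lborel \<partial>M)"
    by (subst P.Fubini') (auto simp: sets cong: measurable_cong_sets)
  also have "\<dots> = (\<integral>\<^sup>+x. \<integral>\<^sup>+y. indicator ?B x * indicator A y \<partial>lborel \<partial>M)"
  proof (rule nn_integral_cong)
    fix x
    have "(\<integral>\<^sup>+y. indicator ?B x * indicator A y \<partial>lborel) = (\<integral>\<^sup>+y. indicator ?B x * indicator A (x + y) \<partial>lborel)"
      by (rule tr[OF invL], simp, measurable)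
    then show "(\<integral>\<^sup>+y. indicator A (y + x) * indicator ?B x \<partial>lborel) = (\<integral>\<^sup>+y. indicator ?B x * indicator A y \<partial>lborel)"
      by (simp only: add.commute mult.commute)
  qed
  also have "\<dots> = emeasure M ?B * emeasure lborel A"
    using A by (subst prod) (auto simp: sets)
  finally have "emeasure M A * emeasure lborel ?B = emeasure lborel A * emeasure lborel ?B"
    by (simp add: ball mult.commute)
  moreover have "emeasure lborel ?B \<noteq> 0" "emeasure lborel ?B \<noteq> top"
    by (auto simp: emeasure_cball ennreal_eq_0_iff not_le)
  ultimately show "emeasure M A = emeasure lborel A"
    by (simp add: mult.commute[of _ "emeasure lborel ?B"] ennreal_mult_cancel_left)
qed

section \<open>Lebesgue measure in orthonormal coordinates\<close>

definition lborel_basis :: "'a::euclidean_space set \<Rightarrow> 'a measure" where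
  "lborel_basis B = distr (\<Pi>\<^sub>M b\<in>B. lborel) borel (\<lambda>f. \<Sum>b\<in>B. f b *\<^sub>R b)"

lemma sets_lborel_basis [simp]: "sets (lborel_basis B) = sets borel"
  and space_lborel_basis [simp]: "space (lborel_basis B) = UNIV"
  by (simp_all add: lborel_basis_def)

lemma measurable_basis_sum [measurable]:
  fixes B :: "'a::euclidean_space set"
  assumes "finite B"
  shows "(\<lambda>f. \<Sum>b\<in>B. f b *\<^sub>R b) \<in> borel_measurable (\<Pi>\<^sub>M b\<in>B. lborel)"
  by measurable

locale orthonormal =
  fixes B :: "'a::euclidean_space set"
  assumes orth: "pairwise orthogonal B" and norm1: "\<And>b. b \<in> B \<Longrightarrow> norm b = 1"
begin

lemma fin: "finite B"
  using orth norm1 by (intro pairwise_orthogonal_imp_finite) auto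

lemma card_eq_dim: "card B = dim (span B)"
proof -
  have "0 \<notin> B" using norm1 by force
  then show ?thesis using pairwise_orthogonal_independent[OF orth] by (simp add: dim_eq_card_independent)
qed

lemma inner_sum: "c \<in> B \<Longrightarrow> (\<Sum>b\<in>B. f b *\<^sub>R b) \<bullet> c = f c"
proof -
  assume c: "c \<in> B"
  have "(\<Sum>b\<in>B. f b *\<^sub>R b) \<bullet> c = (\<Sum>b\<in>B. f b * (b \<bullet> c))" by (simp add: inner_sum_left)
  also have "\<dots> = (\<Sum>b\<in>B. if b = c then f c else 0)"
    using orth norm1 c by (intro sum.cong) (auto simp: pairwise_def orthogonal_def norm_eq_1)
  also have "\<dots> = f c" using c fin by simp
  finally show ?thesis .
qed

lemma norm_sum: "norm (\<Sum>b\<in>B. f b *\<^sub>R b) = sqrt (\<Sum>b\<in>B. (f b)\<^sup>2)"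
proof -
  have "(\<Sum>b\<in>B. f b *\<^sub>R b) \<bullet> (\<Sum>b\<in>B. f b *\<^sub>R b) = (\<Sum>b\<in>B. f b * ((\<Sum>b\<in>B. f b *\<^sub>R b) \<bullet> b))"
    by (simp only: inner_sum_right inner_scaleR_right)
  also have "\<dots> = (\<Sum>b\<in>B. (f b)\<^sup>2)" by (intro sum.cong) (simp_all add: inner_sum power2_eq_square)
  finally show ?thesis by (simp add: norm_eq_sqrt_inner)
qed

lemma emeasure_cball_lborel_basis:
  assumes "r > 0"
  shows "emeasure (lborel_basis B) (cball 0 r) = ennreal (unit_ball_vol (real (card B)) * r ^ card B)"
proof -
  have "emeasure (lborel_basis B) (cball 0 r) =
      emeasure (\<Pi>\<^sub>M b\<in>B. lborel) ({f. sqrt (\<Sum>b\<in>B. (f b)\<^sup>2) \<le> r} \<inter> space (\<Pi>\<^sub>M b\<in>B. lborel))"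
    unfolding lborel_basis_def using fin
    by (subst emeasure_distr) (auto simp: norm_sum vimage_def)
  then show ?thesis using emeasure_cball_aux[OF fin assms] by simp
qed

lemma sigma_finite_lborel_basis: "sigma_finite_measure (lborel_basis B)"
proof
  show "\<exists>A. countable A \<and> A \<subseteq> sets (lborel_basis B) \<and> \<Union>A = space (lborel_basis B) \<and>
     (\<forall>a\<in>A. emeasure (lborel_basis B) a \<noteq> \<infinity>)"
  proof (intro exI conjI)
    have "\<exists>n::nat. x \<in> cball 0 (real n + 1)" for x :: 'a
    proof -
      obtain n where "norm x \<le> real n" using real_arch_simple by blast
      then have "x \<in> cball 0 (real n + 1)" by simp
      then show ?thesis by blast
    qed
    then show "\<Union>(range (\<lambda>n::nat. cball 0 (real n + 1))) = space (lborel_basis B)" by auto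
  qed (auto simp: emeasure_cball_lborel_basis)
qed

lemma translation_lborel_basis:
  assumes "v \<in> span B"
  shows "distr (lborel_basis B) borel (\<lambda>x. v + x) = lborel_basis B"
proof -
  interpret product_sigma_finite "\<lambda>b::'a. lborel :: real measure" ..
  have v: "v = (\<Sum>b\<in>B. (v \<bullet> b) *\<^sub>R b)"
  proof -
    obtain g where "v = (\<Sum>b\<in>B. g b *\<^sub>R b)" using assms unfolding span_finite[OF fin] by auto
    then show ?thesis by (auto simp: inner_sum intro!: sum.cong)
  qed
  \<comment> \<open>The translation in coordinates, restricted to B because points of the product
    space are extensional functions.\<close>
  let ?s = "\<lambda>f::'a \<Rightarrow> real. \<lambda>b\<in>B. v \<bullet> b + f b"
  have m [measurable]: "?s \<in> (\<Pi>\<^sub>M b\<in>B. lborel) \<rightarrow>\<^sub>M (\<Pi>\<^sub>M b\<in>B. lborel)"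
    by measurable
  have P: "distr (\<Pi>\<^sub>M b\<in>B. lborel) (\<Pi>\<^sub>M b\<in>B. lborel) ?s = (\<Pi>\<^sub>M b\<in>B. lborel)"
  proof (rule PiM_eqI[OF fin])
    fix A :: "'a \<Rightarrow> real set" assume A: "\<And>b. b \<in> B \<Longrightarrow> A b \<in> sets lborel"
    have A': "\<And>b. b \<in> B \<Longrightarrow> (\<lambda>x. v \<bullet> b + x) -` A b \<in> sets borel"
      using A by (intro measurable_sets[where M=borel and A=borel, simplified]) auto
    have "?s -` Pi\<^sub>E B A \<inter> space (\<Pi>\<^sub>M b\<in>B. lborel) = Pi\<^sub>E B (\<lambda>b. (\<lambda>x. v \<bullet> b + x) -` A b)"
      by (auto simp: space_PiM PiE_def Pi_def)
    then have "emeasure (distr (\<Pi>\<^sub>M b\<in>B. lborel) (\<Pi>\<^sub>M b\<in>B. lborel) ?s) (Pi\<^sub>E B A)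
        = emeasure (\<Pi>\<^sub>M b\<in>B. lborel) (Pi\<^sub>E B (\<lambda>b. (\<lambda>x. v \<bullet> b + x) -` A b))"
      using A fin by (subst emeasure_distr) (auto intro!: sets_PiM_I_finite)
    also have "\<dots> = (\<Prod>b\<in>B. emeasure lborel ((\<lambda>x. v \<bullet> b + x) -` A b))"
      using A' fin by (subst emeasure_PiM) auto
    also have "\<dots> = (\<Prod>b\<in>B. emeasure lborel (A b))"
    proof (intro prod.cong refl)
      fix b assume b: "b \<in> B"
      have "emeasure lborel ((\<lambda>x. v \<bullet> b + x) -` A b) = emeasure (distr lborel borel (\<lambda>x. v \<bullet> b + x)) (A b)"
        using A[OF b] by (subst emeasure_distr) auto
      then show "emeasure lborel ((\<lambda>x. v \<bullet> b + x) -` A b) = emeasure lborel (A b)"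
        by (simp add: lborel_distr_plus)
    qed
    finally show "emeasure (distr (\<Pi>\<^sub>M b\<in>B. lborel) (\<Pi>\<^sub>M b\<in>B. lborel) ?s) (Pi\<^sub>E B A) = (\<Prod>b\<in>B. emeasure lborel (A b))" .
  qed auto
  have "distr (lborel_basis B) borel (\<lambda>x. v + x)
      = distr (\<Pi>\<^sub>M b\<in>B. lborel) borel (\<lambda>f. v + (\<Sum>b\<in>B. f b *\<^sub>R b))"
    unfolding lborel_basis_def using fin by (subst distr_distr) (auto simp: comp_def)
  also have "(\<lambda>f. v + (\<Sum>b\<in>B. f b *\<^sub>R b)) = (\<lambda>f. \<Sum>b\<in>B. f b *\<^sub>R b) \<circ> ?s"
    by (subst v) (auto simp: fun_eq_iff scaleR_add_left sum.distrib)
  also have "distr (\<Pi>\<^sub>M b\<in>B. lborel) borel \<dots> =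
      distr (distr (\<Pi>\<^sub>M b\<in>B. lborel) (\<Pi>\<^sub>M b\<in>B. lborel) ?s) borel (\<lambda>f. \<Sum>b\<in>B. f b *\<^sub>R b)"
    using fin by (subst distr_distr) auto
  also have "\<dots> = lborel_basis B" unfolding P lborel_basis_def ..
  finally show ?thesis .
qed

text \<open>Lets coordinates adapted to a hyperplane, an orthonormal basis of it together with its
  normal, compute ordinary volume.\<close>

lemma lborel_basis_eq_lborel:
  assumes "span B = UNIV"
  shows "lborel_basis B = lborel"
proof (rule translation_invariant_unique)
  have "card B = DIM('a)" using card_eq_dim assms by (simp flip: dim_span[of B])
  then show "emeasure (lborel_basis B) (cball 0 1) = emeasure lborel (cball 0 (1::real) :: 'a set)"
    by (simp add: emeasure_cball_lborel_basis emeasure_cball)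
qed (auto simp: assms translation_lborel_basis sigma_finite_lborel_basis)

end

section \<open>The measure on a hyperplane\<close>

lemma lborel_subspace_hyperplane:
  fixes \<xi> :: "'a::euclidean_space"
  assumes "norm \<xi> = 1"
  obtains B where "lborel_subspace ({\<xi>}\<^sup>\<bottom>) = lborel_basis B" "orthonormal B" "orthonormal (insert \<xi> B)"
    "\<xi> \<notin> B" "span (insert \<xi> B) = UNIV" "span B = {\<xi>}\<^sup>\<bottom>" "card B = DIM('a) - 1"
proof -
  define B where "B = (SOME B. orthonormal_basis_of ({\<xi>}\<^sup>\<bottom>) B)"
  have "orthonormal_basis_of ({\<xi>}\<^sup>\<bottom>) B"
    unfolding B_def by (rule someI_ex, rule ex_orthonormal_basis_of, rule subspace_orthogonal_comp)
  then have B: "B \<subseteq> {\<xi>}\<^sup>\<bottom>" "span B = {\<xi>}\<^sup>\<bottom>" "pairwise orthogonal B" "\<And>b. b \<in> B \<Longrightarrow> norm b = 1"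
    by (auto simp: orthonormal_basis_of_def)
  have perp: "b \<bullet> \<xi> = 0" if "b \<in> {\<xi>}\<^sup>\<bottom>" for b
    using that by (auto simp: orthogonal_comp_def orthogonal_def inner_commute)
  have xx: "\<xi> \<bullet> \<xi> = 1" using assms by (simp add: norm_eq_1)
  have o: "orthonormal B" using B by (unfold_locales) auto
  have o2: "orthonormal (insert \<xi> B)"
    using B assms perp by (unfold_locales) (auto simp: pairwise_insert orthogonal_def inner_commute subset_iff)
  have nin: "\<xi> \<notin> B" using B(1) perp xx by fastforce
  have s: "span (insert \<xi> B) = UNIV"
  proof -
    have "x \<in> span (insert \<xi> B)" for x
    proof -
      have "x - (x \<bullet> \<xi>) *\<^sub>R \<xi> \<in> {\<xi>}\<^sup>\<bottom>"
        by (auto simp: orthogonal_comp_def orthogonal_def inner_diff_right xx inner_commute)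
      then have "x - (x \<bullet> \<xi>) *\<^sub>R \<xi> \<in> span (insert \<xi> B)"
        using B(2) span_mono[of B "insert \<xi> B"] by blast
      moreover have "(x \<bullet> \<xi>) *\<^sub>R \<xi> \<in> span (insert \<xi> B)" by (intro span_scale span_base) simp
      ultimately show ?thesis using span_add by fastforce
    qed
    then show ?thesis by blast
  qed
  have "card (insert \<xi> B) = DIM('a)"
    unfolding orthonormal.card_eq_dim[OF o2] s by simp
  then have "card B = DIM('a) - 1" using nin orthonormal.fin[OF o] by simp
  moreover have "lborel_subspace ({\<xi>}\<^sup>\<bottom>) = lborel_basis B"
    unfolding lborel_subspace_def lborel_basis_def B_def Let_def ..
  ultimately show thesis using that o o2 nin s B(2) by blast
qed

lemma sets_lborel_subspace [simp, measurable_cong]: "sets (lborel_subspace S) = sets borel"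
  by (simp add: lborel_subspace_def Let_def)

lemma emeasure_lborel_subspace_bounded:
  fixes A :: "'a::euclidean_space set"
  assumes "norm \<xi> = 1" "bounded A"
  shows "emeasure (lborel_subspace ({\<xi>}\<^sup>\<bottom>)) A < \<infinity>"
proof -
  obtain B where B: "lborel_subspace ({\<xi>}\<^sup>\<bottom>) = lborel_basis B" "orthonormal B"
    using lborel_subspace_hyperplane[OF assms(1)] by metis
  obtain r where r: "A \<subseteq> cball 0 r" "r > 0"
    using bounded_subset_ballD[OF assms(2), of 0] ball_subset_cball by blast
  have "emeasure (lborel_basis B) A \<le> emeasure (lborel_basis B) (cball 0 r)"
    by (rule emeasure_mono[OF r(1)]) simp
  also have "\<dots> < \<infinity>" by (simp add: orthonormal.emeasure_cball_lborel_basis[OF B(2) r(2)])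
  finally show ?thesis unfolding B(1) .
qed

text \<open>The hyperplane measure is defined on Borel sets of the whole space. Arguments on a
  single line through y need y orthogonal to the direction, which therefore enters as an
  almost-everywhere condition.\<close>

lemma AE_lborel_subspace:
  fixes \<xi> :: "'a::euclidean_space"
  assumes "norm \<xi> = 1"
  shows "AE y in lborel_subspace ({\<xi>}\<^sup>\<bottom>). y \<bullet> \<xi> = 0"
proof -
  obtain B where B: "lborel_subspace ({\<xi>}\<^sup>\<bottom>) = lborel_basis B" "orthonormal B" "span B = {\<xi>}\<^sup>\<bottom>"
    using lborel_subspace_hyperplane[OF assms] by metis
  have "b \<bullet> \<xi> = 0" if "b \<in> B" for b
    using span_base[OF that] B(3) by (auto simp: orthogonal_comp_def orthogonal_def inner_commute)
  then show ?thesis unfolding B(1) lborel_basis_def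
    using orthonormal.fin[OF B(2)] by (subst AE_distr_iff) (auto simp: inner_sum_left)
qed

text \<open>Fubini in the coordinates \<open>insert \<xi> B\<close>, with the coordinate along \<xi>
  split off. Here the chosen basis of the hyperplane disappears behind
  \<open>lborel\<close>.\<close>

lemma nn_integral_slices:
  fixes F :: "'a::euclidean_space \<Rightarrow> ennreal"
  assumes "norm \<xi> = 1" and [measurable]: "F \<in> borel_measurable borel"
  shows "(\<integral>\<^sup>+x. F x \<partial>lborel) = (\<integral>\<^sup>+y. \<integral>\<^sup>+s. F (y + s *\<^sub>R \<xi>) \<partial>lborel \<partial>lborel_subspace ({\<xi>}\<^sup>\<bottom>))"
proof -
  obtain B where B: "lborel_subspace ({\<xi>}\<^sup>\<bottom>) = lborel_basis B" "orthonormal B" "orthonormal (insert \<xi> B)"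
    "\<xi> \<notin> B" "span (insert \<xi> B) = UNIV"
    using lborel_subspace_hyperplane[OF assms(1)] by metis
  interpret product_sigma_finite "\<lambda>b::'a. lborel :: real measure" ..
  have fin [simp]: "finite B" using B(2) by (rule orthonormal.fin)
  have "(\<integral>\<^sup>+x. F x \<partial>lborel) = (\<integral>\<^sup>+x. F x \<partial>lborel_basis (insert \<xi> B))"
    by (simp add: orthonormal.lborel_basis_eq_lborel[OF B(3,5)])
  also have "\<dots> = (\<integral>\<^sup>+f. F (\<Sum>b\<in>insert \<xi> B. f b *\<^sub>R b) \<partial>(\<Pi>\<^sub>M b\<in>insert \<xi> B. lborel))"
    unfolding lborel_basis_def by (subst nn_integral_distr) auto
  also have "\<dots> = (\<integral>\<^sup>+f. \<integral>\<^sup>+s. F (\<Sum>b\<in>insert \<xi> B. (f(\<xi> := s)) b *\<^sub>R b) \<partial>lborel \<partial>(\<Pi>\<^sub>M b\<in>B. lborel))"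
    by (rule product_nn_integral_insert) (use B(4) in auto)
  also have "\<dots> = (\<integral>\<^sup>+f. \<integral>\<^sup>+s. F ((\<Sum>b\<in>B. f b *\<^sub>R b) + s *\<^sub>R \<xi>) \<partial>lborel \<partial>(\<Pi>\<^sub>M b\<in>B. lborel))"
  proof (intro nn_integral_cong)
    fix f s
    have "(\<Sum>b\<in>insert \<xi> B. (f(\<xi> := s)) b *\<^sub>R b) = (\<Sum>b\<in>B. f b *\<^sub>R b) + s *\<^sub>R \<xi>"
      using B(4) by (auto simp: add.commute intro!: sum.cong)
    then show "F (\<Sum>b\<in>insert \<xi> B. (f(\<xi> := s)) b *\<^sub>R b) = F ((\<Sum>b\<in>B. f b *\<^sub>R b) + s *\<^sub>R \<xi>)" by simp
  qed
  also have "\<dots> = (\<integral>\<^sup>+y. \<integral>\<^sup>+s. F (y + s *\<^sub>R \<xi>) \<partial>lborel \<partial>lborel_basis B)"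
    unfolding lborel_basis_def by (subst nn_integral_distr) auto
  finally show ?thesis unfolding B(1) .
qed

section \<open>Adding segments and zonotopes\<close>

lemma compact_proj_perp:
  fixes K :: "'a::euclidean_space set"
  shows "compact K \<Longrightarrow> compact (proj_perp \<xi> K)"
  unfolding proj_perp_def by (intro compact_continuous_image continuous_intros)

lemma borel_proj_perp:
  fixes K :: "'a::euclidean_space set"
  shows "compact K \<Longrightarrow> proj_perp \<xi> K \<in> sets borel"
  by (intro borel_closed compact_imp_closed compact_proj_perp)

lemma fmeasurable_proj_perp:
  fixes K :: "'a::euclidean_space set"
  assumes "compact K" "norm \<xi> = 1"
  shows "proj_perp \<xi> K \<in> fmeasurable (lborel_subspace ({\<xi>}\<^sup>\<bottom>))"
  using compact_proj_perp[OF assms(1)] emeasure_lborel_subspace_bounded[OF assms(2)]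
  by (intro fmeasurableI) (auto simp: compact_imp_bounded borel_closed compact_imp_closed)

lemma proj_vol_mono:
  fixes K C :: "'a::euclidean_space set"
  assumes "K \<subseteq> C" "compact K" "compact C" "norm \<xi> = 1"
  shows "proj_vol K \<xi> \<le> proj_vol C \<xi>"
  unfolding proj_vol_def
  by (rule measure_mono_fmeasurable)
     (use assms fmeasurable_proj_perp borel_proj_perp in \<open>auto simp: proj_perp_def\<close>)

lemma proj_perp_iff:
  fixes y :: "'a::euclidean_space"
  assumes "norm \<xi> = 1" "y \<bullet> \<xi> = 0"
  shows "y \<in> proj_perp \<xi> K \<longleftrightarrow> (\<exists>s. y + s *\<^sub>R \<xi> \<in> K)"
proof
  assume "y \<in> proj_perp \<xi> K"
  then obtain x where "x \<in> K" "y = x - (x \<bullet> \<xi>) *\<^sub>R \<xi>" by (auto simp: proj_perp_def)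
  then have "y + (x \<bullet> \<xi>) *\<^sub>R \<xi> \<in> K" by simp
  then show "\<exists>s. y + s *\<^sub>R \<xi> \<in> K" ..
next
  assume "\<exists>s. y + s *\<^sub>R \<xi> \<in> K"
  then obtain s where "y + s *\<^sub>R \<xi> \<in> K" ..
  moreover have "y = (y + s *\<^sub>R \<xi>) - ((y + s *\<^sub>R \<xi>) \<bullet> \<xi>) *\<^sub>R \<xi>"
    using assms by (simp add: inner_add_left norm_eq_1)
  ultimately show "y \<in> proj_perp \<xi> K" unfolding proj_perp_def by blast
qed

text \<open>A line that misses K is covered by the case a > b, where the interval is empty.\<close>

lemma line_slice:
  fixes K :: "'a::euclidean_space set"
  assumes "compact K" "convex K" "norm \<xi> = 1"
  obtains a b where "{s. y + s *\<^sub>R \<xi> \<in> K} = {a..b}"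
proof -
  let ?S = "{s. y + s *\<^sub>R \<xi> \<in> K}"
  have S: "?S = (\<lambda>s. y + s *\<^sub>R \<xi>) -` K" by auto
  have "closed ?S" unfolding S
    using assms(1) by (intro continuous_closed_vimage compact_imp_closed) (auto intro!: continuous_intros)
  moreover have "bounded ?S"
  proof -
    obtain r where r: "\<And>x. x \<in> K \<Longrightarrow> norm x \<le> r" using compact_imp_bounded[OF assms(1)] by (auto simp: bounded_iff)
    have "\<bar>s\<bar> \<le> r + norm y" if "y + s *\<^sub>R \<xi> \<in> K" for s
      using r[OF that] norm_triangle_ineq4[of "y + s *\<^sub>R \<xi>" y] assms(3) by simp
    then show ?thesis by (auto simp: bounded_iff)
  qed
  moreover have "convex ?S"
  proof (rule convexI)
    fix s u a b :: real assume s: "s \<in> ?S" "u \<in> ?S" and ab: "0 \<le> a" "0 \<le> b" "a + b = 1"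
    have "a *\<^sub>R (y + s *\<^sub>R \<xi>) + b *\<^sub>R (y + u *\<^sub>R \<xi>) \<in> K"
      using s ab assms(2) by (auto simp: convex_def)
    also have "a *\<^sub>R (y + s *\<^sub>R \<xi>) + b *\<^sub>R (y + u *\<^sub>R \<xi>) = (a + b) *\<^sub>R y + (a * s + b * u) *\<^sub>R \<xi>"
      by (simp add: algebra_simps)
    finally show "a *\<^sub>R s + b *\<^sub>R u \<in> ?S" using ab by simp
  qed
  ultimately have "connected ?S \<and> compact ?S" by (simp add: convex_connected compact_eq_bounded_closed)
  then show thesis using that connected_compact_interval_1 by (metis cbox_interval)
qed

text \<open>On a line parallel to \<xi> that meets K the slice is an interval and grows by t at both
  ends; on any other line it stays empty. The lines that meet K are the points of the
  projection.\<close>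

lemma emeasure_add_segment:
  fixes K :: "'a::euclidean_space set"
  assumes K: "compact K" "convex K" and \<xi>: "norm \<xi> = 1" and t: "t \<ge> 0"
  shows "emeasure lborel (K + closed_segment (- t *\<^sub>R \<xi>) (t *\<^sub>R \<xi>)) =
    emeasure lborel K + ennreal (2 * t) * emeasure (lborel_subspace ({\<xi>}\<^sup>\<bottom>)) (proj_perp \<xi> K)"
proof -
  let ?K' = "K + closed_segment (- t *\<^sub>R \<xi>) (t *\<^sub>R \<xi>)" and ?M = "lborel_subspace ({\<xi>}\<^sup>\<bottom>)"
  have cK': "compact ?K'" using K by (intro compact_set_plus) auto
  have m [measurable]: "K \<in> sets borel" "?K' \<in> sets borel" "proj_perp \<xi> K \<in> sets borel"
    using K cK' borel_proj_perp by (auto simp: borel_closed compact_imp_closed)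
  have seg: "closed_segment (- t *\<^sub>R \<xi>) (t *\<^sub>R \<xi>) = (\<lambda>u. u *\<^sub>R \<xi>) ` {- t..t}"
  proof -
    have "closed_segment (- t *\<^sub>R \<xi>) (t *\<^sub>R \<xi>) = (\<lambda>u. u *\<^sub>R \<xi>) ` closed_segment (- t) t"
      by (rule closed_segment_linear_image) (simp add: bounded_linear.linear bounded_linear_scaleR_left)
    then show ?thesis using t by (simp add: closed_segment_eq_real_ivl)
  qed
  have slice: "(\<integral>\<^sup>+s. indicator ?K' (y + s *\<^sub>R \<xi>) \<partial>lborel) =
      (\<integral>\<^sup>+s. indicator K (y + s *\<^sub>R \<xi>) \<partial>lborel) + ennreal (2 * t) * indicator (proj_perp \<xi> K) y"
    if y: "y \<bullet> \<xi> = 0" for y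
  proof -
    let ?S = "{s. y + s *\<^sub>R \<xi> \<in> K}" and ?S' = "{s. y + s *\<^sub>R \<xi> \<in> ?K'}"
    obtain a b where ab: "?S = {a..b}" using line_slice[OF K \<xi>] by metis
    have i: "(\<integral>\<^sup>+s. indicator C (y + s *\<^sub>R \<xi>) \<partial>lborel) = emeasure lborel {s. y + s *\<^sub>R \<xi> \<in> C}"
      if [measurable]: "C \<in> sets borel" for C
    proof -
      have "{s. y + s *\<^sub>R \<xi> \<in> C} \<in> sets lborel" by measurable
      then have "emeasure lborel {s. y + s *\<^sub>R \<xi> \<in> C} = (\<integral>\<^sup>+s. indicator {s. y + s *\<^sub>R \<xi> \<in> C} s \<partial>lborel)"
        by (rule nn_integral_indicator[symmetric])
      also have "\<dots> = (\<integral>\<^sup>+s. indicator C (y + s *\<^sub>R \<xi>) \<partial>lborel)"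
        by (rule nn_integral_cong) (simp add: indicator_def)
      finally show ?thesis ..
    qed
    have S': "s \<in> ?S' \<longleftrightarrow> (\<exists>u\<in>{- t..t}. s - u \<in> ?S)" for s
    proof
      assume "s \<in> ?S'"
      then obtain x u where u: "x \<in> K" "u \<in> {- t..t}" "y + s *\<^sub>R \<xi> = x + u *\<^sub>R \<xi>"
        unfolding seg set_plus_def by auto
      then have "y + (s - u) *\<^sub>R \<xi> = x" by (simp add: algebra_simps)
      then show "\<exists>u\<in>{- t..t}. s - u \<in> ?S" using u by auto
    next
      assume "\<exists>u\<in>{- t..t}. s - u \<in> ?S"
      then obtain u where u: "u \<in> {- t..t}" "y + (s - u) *\<^sub>R \<xi> \<in> K" by auto
      have "y + s *\<^sub>R \<xi> = (y + (s - u) *\<^sub>R \<xi>) + u *\<^sub>R \<xi>" by (simp add: algebra_simps)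
      then show "s \<in> ?S'" using u unfolding seg set_plus_def by blast
    qed
    show ?thesis
    proof (cases "a \<le> b")
      case True
      have "?S' = {a - t..b + t}"
      proof (intro set_eqI)
        fix s
        have "s \<in> ?S' \<longleftrightarrow> (\<exists>u\<in>{- t..t}. s - u \<in> {a..b})" unfolding S' ab ..
        also have "\<dots> \<longleftrightarrow> s \<in> {a - t..b + t}"
        proof
          assume "s \<in> {a - t..b + t}"
          \<comment> \<open>The witness is the least admissible shift u with s - u \<le> b.\<close>
          then show "\<exists>u\<in>{- t..t}. s - u \<in> {a..b}"
            using True t by (intro bexI[of _ "max (- t) (s - b)"]) (auto simp: max_def)
        qed auto
        finally show "s \<in> ?S' \<longleftrightarrow> s \<in> {a - t..b + t}" .
      qed
      moreover have "y \<in> proj_perp \<xi> K"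
        using proj_perp_iff[OF \<xi> y] ab True by (metis atLeastAtMost_iff mem_Collect_eq order_refl)
      ultimately show ?thesis using True t
        unfolding i[OF m(1)] i[OF m(2)] ab by (simp flip: ennreal_plus)
    next
      case False
      then have e: "?S = {}" using ab by simp
      then have "?S' = {}" using S' by blast
      moreover have "y \<notin> proj_perp \<xi> K" using proj_perp_iff[OF \<xi> y] e by blast
      ultimately show ?thesis unfolding i[OF m(1)] i[OF m(2)] e by simp
    qed
  qed
  have "emeasure lborel ?K' = (\<integral>\<^sup>+x. indicator ?K' x \<partial>lborel)"
    by (rule nn_integral_indicator[symmetric]) (use m(2) in simp)
  also have "\<dots> = (\<integral>\<^sup>+y. \<integral>\<^sup>+s. indicator ?K' (y + s *\<^sub>R \<xi>) \<partial>lborel \<partial>?M)"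
    by (rule nn_integral_slices[OF \<xi>]) measurable
  also have "\<dots> = (\<integral>\<^sup>+y. (\<integral>\<^sup>+s. indicator K (y + s *\<^sub>R \<xi>) \<partial>lborel) + ennreal (2 * t) * indicator (proj_perp \<xi> K) y \<partial>?M)"
    by (rule nn_integral_cong_AE) (use AE_lborel_subspace[OF \<xi>] slice in \<open>auto elim!: eventually_mono\<close>)
  also have "\<dots> = (\<integral>\<^sup>+y. (\<integral>\<^sup>+s. indicator K (y + s *\<^sub>R \<xi>) \<partial>lborel) \<partial>?M) + (\<integral>\<^sup>+y. ennreal (2 * t) * indicator (proj_perp \<xi> K) y \<partial>?M)"
    by (rule nn_integral_add) measurable
  also have "(\<integral>\<^sup>+y. (\<integral>\<^sup>+s. indicator K (y + s *\<^sub>R \<xi>) \<partial>lborel) \<partial>?M) = emeasure lborel K"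
    by (subst nn_integral_slices[OF \<xi>, symmetric]) auto
  also have "(\<integral>\<^sup>+y. ennreal (2 * t) * indicator (proj_perp \<xi> K) y \<partial>?M) = ennreal (2 * t) * emeasure ?M (proj_perp \<xi> K)"
    by (rule nn_integral_cmult_indicator) simp
  finally show ?thesis .
qed

text \<open>
  The 1-homogeneous extension of \<open>proj_vol K\<close> from the unit sphere; the value at \<open>0\<close> is \<open>0\<close>.
\<close>

definition proj_vol_dir :: "'a::euclidean_space set \<Rightarrow> 'a \<Rightarrow> real" where
  "proj_vol_dir K v = norm v * proj_vol K (v /\<^sub>R norm v)"

lemma measure_add_segment:
  fixes K :: "'a::euclidean_space set"
  assumes K: "compact K" "convex K"
  shows "measure lebesgue (K + closed_segment (- v) v) = measure lebesgue K + 2 * proj_vol_dir K v"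
proof (cases "v = 0")
  case True
  then show ?thesis by (simp add: proj_vol_dir_def set_plus_def)
next
  case False
  define \<xi> where "\<xi> = v /\<^sub>R norm v"
  have \<xi>: "norm \<xi> = 1" and v: "v = norm v *\<^sub>R \<xi>" using False by (simp_all add: \<xi>_def)
  let ?M = "lborel_subspace ({\<xi>}\<^sup>\<bottom>)"
  have b: "A \<in> sets borel" "emeasure lborel A = ennreal (measure lebesgue A)" if "compact A" for A :: "'a set"
  proof -
    show A: "A \<in> sets borel" using that by (simp add: borel_closed compact_imp_closed)
    have "emeasure lborel A = ennreal (measure lborel A)"
      using fmeasurable_compact[OF that] by (simp add: emeasure_eq_measure2)
    then show "emeasure lborel A = ennreal (measure lebesgue A)" using A by simp
  qed
  have "compact (K + closed_segment (- v) v)" using K by (intro compact_set_plus) auto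
  moreover have "emeasure ?M (proj_perp \<xi> K) = ennreal (proj_vol K \<xi>)"
    unfolding proj_vol_def using fmeasurable_proj_perp[OF K(1) \<xi>] by (simp add: emeasure_eq_measure2)
  moreover have "emeasure lborel (K + closed_segment (- v) v) =
      emeasure lborel K + ennreal (2 * norm v) * emeasure ?M (proj_perp \<xi> K)"
    using emeasure_add_segment[OF K \<xi>, of "norm v"] by (simp flip: v)
  moreover have pos: "0 \<le> measure lebesgue K" "0 \<le> 2 * norm v" "0 \<le> proj_vol K \<xi>" "0 \<le> 2 * norm v * proj_vol K \<xi>"
    by (simp_all add: proj_vol_def)
  ultimately have "ennreal (measure lebesgue (K + closed_segment (- v) v)) =
      ennreal (measure lebesgue K + 2 * norm v * proj_vol K \<xi>)"
    using b[of K] b[of "K + closed_segment (- v) v"] K pos by (simp only: ennreal_plus ennreal_mult)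
  then show ?thesis using pos by (simp add: proj_vol_dir_def \<xi>_def del: ennreal_plus)
qed

lemma proj_vol_dir_mono:
  assumes "K \<subseteq> C" "compact K" "compact C"
  shows "proj_vol_dir K v \<le> proj_vol_dir C v"
proof (cases "v = 0")
  case False
  then show ?thesis unfolding proj_vol_dir_def
    using assms by (intro mult_left_mono proj_vol_mono) auto
qed (simp add: proj_vol_dir_def)

lemma proj_vol_dir_scaleR: "c > 0 \<Longrightarrow> proj_vol_dir K (c *\<^sub>R v) = c * proj_vol_dir K v"
  by (cases "v = 0") (simp_all add: proj_vol_dir_def field_simps)

lemma measure_scaleR_image:
  fixes K :: "'a::euclidean_space set"
  assumes "compact K" "c > 0"
  shows "measure lebesgue ((*\<^sub>R) c ` K) = c ^ DIM('a) * measure lebesgue K"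
proof -
  have "emeasure lebesgue ((\<lambda>x. c *\<^sub>R x + 0) ` K) = ennreal (\<bar>c\<bar> ^ DIM('a)) * emeasure lebesgue K"
    by (rule emeasure_lebesgue_affine)
  then show ?thesis using assms by (simp add: measure_def enn2real_mult)
qed

lemma scaleR_image_add:
  fixes A B :: "'a::real_vector set"
  shows "(*\<^sub>R) c ` (A + B) = (*\<^sub>R) c ` A + (*\<^sub>R) c ` B"
  by (force simp: set_plus_def scaleR_add_right)

lemma scaleR_image_segment:
  fixes v :: "'a::real_vector"
  shows "(*\<^sub>R) c ` closed_segment (- v) v = closed_segment (- (c *\<^sub>R v)) (c *\<^sub>R v)"
  using closed_segment_linear_image[of "(*\<^sub>R) c" "- v" v] by (simp add: linear_scaleR)

text \<open>
  Compares the volume of \<open>K\<close> plus a segment with that of its image under \<open>c\<close>, which avoids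
  scaling the hyperplane measure.
\<close>

lemma proj_vol_dir_scaleR_image:
  fixes K :: "'a::euclidean_space set"
  assumes "compact K" "convex K" "c > 0"
  shows "proj_vol_dir ((*\<^sub>R) c ` K) v = c ^ (DIM('a) - 1) * proj_vol_dir K v"
proof -
  have cK: "compact ((*\<^sub>R) c ` K)" "convex ((*\<^sub>R) c ` K)"
    using assms by (auto intro: compact_scaling convex_scaling)
  have "c ^ DIM('a) * measure lebesgue (K + closed_segment (- v) v)
      = measure lebesgue ((*\<^sub>R) c ` K + closed_segment (- (c *\<^sub>R v)) (c *\<^sub>R v))"
    unfolding scaleR_image_segment[symmetric] scaleR_image_add[symmetric]
    using assms by (intro measure_scaleR_image[symmetric] compact_set_plus) auto
  then have "c ^ DIM('a) * (measure lebesgue K + 2 * proj_vol_dir K v)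
      = c ^ DIM('a) * measure lebesgue K + 2 * (c * proj_vol_dir ((*\<^sub>R) c ` K) v)"
    using assms by (simp only: measure_add_segment cK measure_scaleR_image proj_vol_dir_scaleR)
  then have "c ^ DIM('a) * proj_vol_dir K v = c * proj_vol_dir ((*\<^sub>R) c ` K) v"
    by (simp add: distrib_left)
  moreover have "c ^ DIM('a) = c * c ^ (DIM('a) - 1)"
    by (metis DIM_positive power_eq_if less_irrefl)
  ultimately show ?thesis using assms(3) by simp
qed

text \<open>The projection of the ball is its intersection with the hyperplane, and the hyperplane
  measure does not see the rest of the ball. What remains is the volume of the (n-1)-dimensional
  unit ball.\<close>

lemma proj_vol_cball:
  fixes \<xi> :: "'a::euclidean_space"
  assumes "norm \<xi> = 1"
  shows "proj_vol (cball 0 1) \<xi> = unit_ball_vol (real DIM('a) - 1)"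
proof -
  let ?M = "lborel_subspace ({\<xi>}\<^sup>\<bottom>)" and ?B = "cball 0 1 :: 'a set"
  obtain B where B: "?M = lborel_basis B" "orthonormal B" "card B = DIM('a) - 1"
    using lborel_subspace_hyperplane[OF assms] by metis
  have "AE y in ?M. y \<in> proj_perp \<xi> ?B \<longleftrightarrow> y \<in> ?B"
    using AE_lborel_subspace[OF assms]
  proof eventually_elim
    case (elim y)
    have "norm y \<le> 1" if "norm (y + s *\<^sub>R \<xi>) \<le> 1" for s
    proof -
      have "(norm (y + s *\<^sub>R \<xi>))\<^sup>2 = (norm y)\<^sup>2 + s\<^sup>2"
        using elim assms unfolding power2_norm_eq_inner
        by (simp add: inner_add_left inner_add_right inner_commute norm_eq_1 power2_eq_square)
      moreover have "(norm (y + s *\<^sub>R \<xi>))\<^sup>2 \<le> 1" using that by (simp add: power_le_one)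
      ultimately have "(norm y)\<^sup>2 \<le> 1" by (smt (verit) zero_le_power2)
      then show ?thesis by (simp add: power_le_one_iff abs_square_le_1)
    qed
    moreover have "norm y \<le> 1 \<Longrightarrow> norm (y + 0 *\<^sub>R \<xi>) \<le> 1" by simp
    ultimately show ?case unfolding proj_perp_iff[OF assms elim] mem_cball_0 by blast
  qed
  then have "measure ?M (proj_perp \<xi> ?B) = measure ?M ?B"
    using compact_proj_perp[of ?B \<xi>]
    by (intro measure_eq_AE) (auto simp: borel_closed compact_imp_closed)
  also have "\<dots> = unit_ball_vol (real (DIM('a) - 1))"
    unfolding measure_def B(1) using orthonormal.emeasure_cball_lborel_basis[OF B(2), of 1]
    by (simp add: B(3))
  finally show ?thesis by (simp add: proj_vol_def of_nat_diff)
qed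

lemma proj_vol_dir_cball:
  fixes v :: "'a::euclidean_space"
  shows "proj_vol_dir (cball 0 1) v = unit_ball_vol (real DIM('a) - 1) * norm v"
  by (cases "v = 0") (simp_all add: proj_vol_dir_def proj_vol_cball)

section \<open>Zonotopes as lists of generators\<close>

fun zonotope :: "'a::real_vector list \<Rightarrow> 'a set" where
  "zonotope [] = {0}"
| "zonotope (v # vs) = closed_segment (- v) v + zonotope vs"

lemma zero_in_segment: "0 \<in> closed_segment (- v) (v :: 'a::real_vector)"
  using midpoint_in_closed_segment[of "- v" v] by (simp add: midpoint_def)

lemma zero_in_zonotope: "0 \<in> zonotope vs"
proof (induction vs)
  case (Cons v vs)
  then show ?case using set_plus_intro[OF zero_in_segment[of v] Cons] by simp
qed simp

lemma compact_zonotope: "compact (zonotope (vs :: 'a::euclidean_space list))"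
  by (induction vs) (auto intro: compact_set_plus)

lemma convex_zonotope: "convex (zonotope vs)"
  by (induction vs) (auto intro: convex_set_plus)

lemma scaleR_image_zonotope: "(*\<^sub>R) c ` zonotope vs = zonotope (map ((*\<^sub>R) c) vs)"
  by (induction vs) (simp_all add: scaleR_image_add scaleR_image_segment)

lemma set_plus_subset: "0 \<in> B \<Longrightarrow> A \<subseteq> A + (B :: 'a::real_vector set)"
  using set_plus_intro[of _ A 0 B] by auto

text \<open>Each segment is added to a partial sum lying inside C, so C bounds the projection volume
  that it contributes.\<close>

lemma measure_add_zonotope_le:
  fixes K :: "'a::euclidean_space set"
  assumes "compact K" "convex K" "K + zonotope vs \<subseteq> C" "compact C"
  shows "measure lebesgue (K + zonotope vs) \<le> measure lebesgue K + 2 * (\<Sum>v\<leftarrow>vs. proj_vol_dir C v)"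
  using assms
proof (induction vs arbitrary: K)
  case Nil
  then show ?case by (simp add: set_plus_def)
next
  case (Cons v vs)
  let ?K' = "K + closed_segment (- v) v"
  have e: "K + zonotope (v # vs) = ?K' + zonotope vs" by (simp add: add.assoc)
  have c: "compact ?K'" "convex ?K'" using Cons.prems by (auto intro: compact_set_plus convex_set_plus)
  have "K \<subseteq> C" using Cons.prems(3) set_plus_subset[OF zero_in_zonotope] by blast
  then have "proj_vol_dir K v \<le> proj_vol_dir C v" using Cons.prems by (intro proj_vol_dir_mono)
  moreover have "measure lebesgue (?K' + zonotope vs) \<le> measure lebesgue ?K' + 2 * (\<Sum>v\<leftarrow>vs. proj_vol_dir C v)"
    using Cons.prems e by (intro Cons.IH c) auto
  ultimately show ?case
    unfolding e using measure_add_segment[OF Cons.prems(1,2), of v] by simp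
qed

text \<open>Dually, all partial sums contain K. Applied to generators scaled by t, the two bounds
  take the place of a derivative at t = 0.\<close>

lemma measure_add_zonotope_ge:
  fixes K :: "'a::euclidean_space set"
  assumes "compact K" "convex K"
  shows "measure lebesgue K + 2 * (\<Sum>v\<leftarrow>vs. proj_vol_dir K v) \<le> measure lebesgue (K + zonotope vs)"
  using assms
proof (induction vs arbitrary: K)
  case Nil
  then show ?case by (simp add: set_plus_def)
next
  case (Cons v vs)
  let ?K' = "K + closed_segment (- v) v"
  have e: "K + zonotope (v # vs) = ?K' + zonotope vs" by (simp add: add.assoc)
  have c: "compact ?K'" "convex ?K'" using Cons.prems by (auto intro: compact_set_plus convex_set_plus)
  have "(\<Sum>v\<leftarrow>vs. proj_vol_dir K v) \<le> (\<Sum>v\<leftarrow>vs. proj_vol_dir ?K' v)"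
    by (intro sum_list_mono proj_vol_dir_mono set_plus_subset zero_in_segment Cons.prems c)
  then show ?case
    unfolding e using measure_add_segment[OF Cons.prems(1,2), of v] Cons.IH[OF c] by simp
qed

section \<open>Minkowski's first inequality for zonotopes\<close>

lemma scaleR_add_image_subset:
  assumes "convex K" "c \<ge> 0"
  shows "K + (*\<^sub>R) c ` K \<subseteq> (*\<^sub>R) (1 + c) ` K"
proof
  fix z assume "z \<in> K + (*\<^sub>R) c ` K"
  then obtain x y where xy: "x \<in> K" "y \<in> K" "z = x + c *\<^sub>R y" by (auto elim!: set_plus_elim)
  have "(1 / (1 + c)) *\<^sub>R x + (c / (1 + c)) *\<^sub>R y \<in> K"
    using assms xy by (intro convexD) (auto simp: field_simps)
  moreover have "z = (1 + c) *\<^sub>R ((1 / (1 + c)) *\<^sub>R x + (c / (1 + c)) *\<^sub>R y)"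
    using assms(2) xy by (simp add: scaleR_add_right)
  ultimately show "z \<in> (*\<^sub>R) (1 + c) ` K" by blast
qed

text \<open>Confines K + tZ, and with it all partial sums, to a dilate of K that shrinks back to K
  as t tends to 0.\<close>

lemma add_scaled_subset:
  assumes "convex K" "c \<ge> 0" "t \<ge> 0" "Z \<subseteq> (*\<^sub>R) c ` K"
  shows "K + (*\<^sub>R) t ` Z \<subseteq> (*\<^sub>R) (1 + t * c) ` K"
proof -
  have "(*\<^sub>R) t ` Z \<subseteq> (*\<^sub>R) (t * c) ` K" using assms(4) by force
  then have "K + (*\<^sub>R) t ` Z \<subseteq> K + (*\<^sub>R) (t * c) ` K" by (intro set_plus_mono2) auto
  also have "\<dots> \<subseteq> (*\<^sub>R) (1 + t * c) ` K" using assms by (intro scaleR_add_image_subset) auto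
  finally show ?thesis .
qed

lemma sum_list_proj_vol_dir_scaleR:
  "t > 0 \<Longrightarrow> (\<Sum>v\<leftarrow>map ((*\<^sub>R) t) vs. proj_vol_dir K v) = t * (\<Sum>v\<leftarrow>vs. proj_vol_dir K v)"
  by (induction vs) (simp_all add: proj_vol_dir_scaleR distrib_left)

lemma measure_pos_convex_body: "convex_body K \<Longrightarrow> measure lebesgue K > 0"
  unfolding convex_body_def
  by (metis interior_empty lmeasurable_compact measure_nonneg less_eq_real_def negligible_iff_measure
      negligible_imp_measure0 open_interior open_not_negligible interior_subset negligible_subset)

text \<open>The left side is n |K|^((n-1)/n) |Z|^(1/n), and the right side is n times the mixed
  volume V(K,...,K,Z). For small t the volume of K + tZ is bounded below by Brunn-Minkowski and
  above by the projections of a slightly larger dilate of K.\<close>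

lemma minkowski_first_zonotope:
  fixes K :: "'a::euclidean_space set"
  assumes K: "convex_body K" "0 \<in> interior K" and Z: "convex_body (zonotope vs)"
  shows "DIM('a) * measure lebesgue K * root DIM('a) (measure lebesgue (zonotope vs) / measure lebesgue K)
    \<le> 2 * (\<Sum>v\<leftarrow>vs. proj_vol_dir K v)"
proof -
  let ?n = "DIM('a)" and ?Z = "zonotope vs" and ?S = "\<Sum>v\<leftarrow>vs. proj_vol_dir K v"
  define r where "r = root ?n (measure lebesgue ?Z / measure lebesgue K)"
  have cK: "compact K" "convex K" and cZ: "compact ?Z" using K Z by (auto simp: convex_body_def)
  have pos: "measure lebesgue K > 0" "measure lebesgue ?Z > 0"
    using measure_pos_convex_body K Z by blast+
  then have r: "r > 0" "r ^ ?n * measure lebesgue K = measure lebesgue ?Z"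
    by (auto simp: r_def real_root_gt_zero)
  obtain e where e: "e > 0" "cball 0 e \<subseteq> K" using K(2) by (auto simp: mem_interior_cball)
  obtain R where R: "R > 0" "\<And>z. z \<in> ?Z \<Longrightarrow> norm z \<le> R" using compact_imp_bounded[OF cZ] bounded_pos by blast
  \<comment> \<open>Z lies in the ball of radius R and K contains the ball of radius e, so Z lies in
    the dilate of K by R/e.\<close>
  define c where "c = R / e"
  have c: "c > 0" using e R by (simp add: c_def)
  have Zc: "?Z \<subseteq> (*\<^sub>R) c ` K"
  proof
    fix z assume "z \<in> ?Z"
    then have "(1 / c) *\<^sub>R z \<in> cball 0 e" using R e by (simp add: c_def field_simps)
    then have "(1 / c) *\<^sub>R z \<in> K" using e by blast
    then have "c *\<^sub>R ((1 / c) *\<^sub>R z) \<in> (*\<^sub>R) c ` K" by blast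
    then show "z \<in> (*\<^sub>R) c ` K" using c by simp
  qed
  have main: "?n * measure lebesgue K * r \<le> 2 * ((1 + t * c) ^ (?n - 1) * ?S)" if t: "t > 0" for t
  proof -
    let ?C = "(*\<^sub>R) (1 + t * c) ` K"
    have tc: "1 + t * c > 0" using t c by (simp add: add_pos_pos)
    have sub: "K + zonotope (map ((*\<^sub>R) t) vs) \<subseteq> ?C"
      using add_scaled_subset[OF cK(2) _ _ Zc, of t] t c by (simp add: scaleR_image_zonotope)
    have "convex_body ((*\<^sub>R) t ` ?Z)"
      using Z t unfolding convex_body_def
      by (auto intro: compact_scaling convex_scaling
          simp: interior_injective_linear_image[OF linear_scaleR[of t]] inj_on_def)
    then have "(1 + t * r) ^ ?n * measure lebesgue K \<le> measure lebesgue (K + (*\<^sub>R) t ` ?Z)"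
      using t r by (intro brunn_minkowski K(1)) (simp_all add: measure_scaleR_image[OF cZ] power_mult_distrib flip: r(2))
    also have "\<dots> = measure lebesgue (K + zonotope (map ((*\<^sub>R) t) vs))"
      by (simp add: scaleR_image_zonotope)
    also have "\<dots> \<le> measure lebesgue K + 2 * (\<Sum>v\<leftarrow>map ((*\<^sub>R) t) vs. proj_vol_dir ?C v)"
      using cK by (intro measure_add_zonotope_le sub compact_scaling)
    also have "\<dots> = measure lebesgue K + 2 * (t * (\<Sum>v\<leftarrow>vs. proj_vol_dir ?C v))"
      by (simp only: sum_list_proj_vol_dir_scaleR[OF t])
    also have "\<dots> = measure lebesgue K + 2 * (t * ((1 + t * c) ^ (?n - 1) * ?S))"
      by (simp add: proj_vol_dir_scaleR_image[OF cK tc] sum_list_const_mult)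
    finally have 1: "(1 + t * r) ^ ?n * measure lebesgue K \<le> measure lebesgue K + 2 * (t * ((1 + t * c) ^ (?n - 1) * ?S))" .
    \<comment> \<open>Bernoulli linearizes the lower bound exactly. After cancelling t only the
      factor (1 + t c)^(n-1) on the right still depends on t.\<close>
    have "(1 + ?n * (t * r)) * measure lebesgue K \<le> (1 + t * r) ^ ?n * measure lebesgue K"
      using t r(1) pos by (intro mult_right_mono Bernoulli_inequality) (auto intro: order_trans[of _ 0])
    then have "t * (?n * measure lebesgue K * r) \<le> t * (2 * ((1 + t * c) ^ (?n - 1) * ?S))"
      using 1 by (simp add: algebra_simps)
    then show ?thesis using t by simp
  qed
  have "((\<lambda>t. 2 * ((1 + t * c) ^ (?n - 1) * ?S)) \<longlongrightarrow> 2 * ((1 + 0 * c) ^ (?n - 1) * ?S)) (at_right 0)"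
    by (intro tendsto_intros)
  moreover have "\<forall>\<^sub>F t in at_right 0. ?n * measure lebesgue K * r \<le> 2 * ((1 + t * c) ^ (?n - 1) * ?S)"
    using main by (auto simp: eventually_at_right_field intro: exI[of _ 1])
  ultimately have "?n * measure lebesgue K * r \<le> 2 * ((1 + 0 * c) ^ (?n - 1) * ?S)"
    by (rule tendsto_lowerbound) simp
  then show ?thesis by (simp add: r_def)
qed

text \<open>For C = L the inclusion of L + tZ in the dilate of L by 1 + t c gives an upper bound; n
  c is the slope of (1 + t c)^n at t = 0.\<close>

lemma sum_proj_vol_dir_le:
  fixes L :: "'a::euclidean_space set" and c :: real
  assumes L: "compact L" "convex L" and c: "c > 0" "zonotope vs \<subseteq> (*\<^sub>R) c ` L"
  shows "2 * (\<Sum>v\<leftarrow>vs. proj_vol_dir L v) \<le> DIM('a) * c * measure lebesgue L"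
proof -
  let ?n = "DIM('a)" and ?S = "\<Sum>v\<leftarrow>vs. proj_vol_dir L v"
  have main: "2 * ?S \<le> c * (\<Sum>i<?n. (1 + t * c) ^ i) * measure lebesgue L" if t: "t > 0" for t
  proof -
    have tc: "1 + t * c > 0" using t c by (simp add: add_pos_pos)
    have "measure lebesgue L + 2 * (\<Sum>v\<leftarrow>map ((*\<^sub>R) t) vs. proj_vol_dir L v)
        \<le> measure lebesgue (L + zonotope (map ((*\<^sub>R) t) vs))"
      by (rule measure_add_zonotope_ge[OF L])
    also have "\<dots> \<le> measure lebesgue ((*\<^sub>R) (1 + t * c) ` L)"
    proof (rule measure_mono_fmeasurable)
      show "L + zonotope (map ((*\<^sub>R) t) vs) \<subseteq> (*\<^sub>R) (1 + t * c) ` L"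
        using add_scaled_subset[OF L(2) _ _ c(2), of t] t c by (simp add: scaleR_image_zonotope)
    qed (use L in \<open>auto intro!: fmeasurableD lmeasurable_compact compact_set_plus compact_zonotope compact_scaling\<close>)
    also have "\<dots> = (1 + t * c) ^ ?n * measure lebesgue L"
      by (rule measure_scaleR_image) (use L tc in auto)
    finally have "2 * t * ?S \<le> ((1 + t * c) ^ ?n - 1) * measure lebesgue L"
      unfolding sum_list_proj_vol_dir_scaleR[OF t] by (simp add: algebra_simps)
    \<comment> \<open>The geometric sum makes the factor t explicit, so it cancels before the limit
      is taken.\<close>
    also have "(1 + t * c) ^ ?n - 1 = t * c * (\<Sum>i<?n. (1 + t * c) ^ i)"
      using power_diff_1_eq[of "1 + t * c" ?n] by simp
    finally have "t * (2 * ?S) \<le> t * (c * (\<Sum>i<?n. (1 + t * c) ^ i) * measure lebesgue L)"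
      by (simp add: algebra_simps)
    then show ?thesis using t by (simp only: mult_le_cancel_left_pos)
  qed
  have "((\<lambda>t. c * (\<Sum>i<?n. (1 + t * c) ^ i) * measure lebesgue L) \<longlongrightarrow> c * (\<Sum>i<?n. (1 + 0 * c) ^ i) * measure lebesgue L) (at_right 0)"
    by (intro tendsto_intros)
  moreover have "\<forall>\<^sub>F t in at_right 0. 2 * ?S \<le> c * (\<Sum>i<?n. (1 + t * c) ^ i) * measure lebesgue L"
    using main by (auto simp: eventually_at_right_field intro: exI[of _ 1])
  ultimately have "2 * ?S \<le> c * (\<Sum>i<?n. (1 + 0 * c) ^ i) * measure lebesgue L"
    by (rule tendsto_lowerbound) simp
  then show ?thesis by (simp add: mult.commute mult.left_commute)
qed

section \<open>Projection bodies are limits of zonotopes\<close>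

text \<open>Serves the squared positive part and the squared distance, whose inner functions are
  themselves not differentiable everywhere.\<close>

lemma has_derivative_quadratic_bound:
  fixes f :: "'a::real_normed_vector \<Rightarrow> real"
  assumes "bounded_linear f'" "\<And>y. \<bar>f y - f x - f' (y - x)\<bar> \<le> (norm (y - x))\<^sup>2"
  shows "(f has_derivative f') (at x)"
  unfolding has_derivative_at_alt
proof (intro conjI allI impI assms(1))
  fix e :: real assume "e > 0"
  show "\<exists>d>0. \<forall>y. norm (y - x) < d \<longrightarrow> norm (f y - f x - f' (y - x)) \<le> e * norm (y - x)"
  proof (intro exI[of _ e] conjI allI impI \<open>e > 0\<close>)
    fix y assume "norm (y - x) < e"
    then have "(norm (y - x))\<^sup>2 \<le> e * norm (y - x)"
      unfolding power2_eq_square by (intro mult_right_mono) auto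
    then show "norm (f y - f x - f' (y - x)) \<le> e * norm (y - x)" using assms(2)[of y] by simp
  qed
qed

lemma DERIV_power2_pos_part: "((\<lambda>u::real. (max 0 u)\<^sup>2) has_real_derivative 2 * max 0 u) (at u)"
  unfolding has_field_derivative_def
proof (rule has_derivative_quadratic_bound)
  fix w :: real
  have "(max 0 w)\<^sup>2 - (max 0 u)\<^sup>2 - 2 * max 0 u * (w - u) = (max 0 w - max 0 u)\<^sup>2 + 2 * max 0 u * ((max 0 w - w) - (max 0 u - u))"
    by (simp add: power2_eq_square algebra_simps)
  \<comment> \<open>Either \<open>max 0 u\<close> is 0 or it equals u, so its product with
    \<open>max 0 u - u\<close> vanishes.\<close>
  also have "\<dots> = (max 0 w - max 0 u)\<^sup>2 + 2 * max 0 u * max 0 (- w)"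
    by (simp add: max_def)
  finally have e: "(max 0 w)\<^sup>2 - (max 0 u)\<^sup>2 - 2 * max 0 u * (w - u) = (max 0 w - max 0 u)\<^sup>2 + 2 * max 0 u * max 0 (- w)" .
  have "0 \<le> (max 0 w - max 0 u)\<^sup>2 + 2 * max 0 u * max 0 (- w)" by simp
  moreover have "(max 0 w - max 0 u)\<^sup>2 + 2 * max 0 u * max 0 (- w) \<le> (w - u)\<^sup>2"
  proof (cases "w \<ge> 0")
    case True
    then have "\<bar>max 0 w - max 0 u\<bar> \<le> \<bar>w - u\<bar>" by (simp add: max_def)
    then have "(max 0 w - max 0 u)\<^sup>2 \<le> (w - u)\<^sup>2" by (simp only: abs_le_square_iff)
    then show ?thesis using True by (simp add: max_def)
  next
    case False
    have "max 0 w = 0" "max 0 (- w) = - w" using False by auto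
    moreover have "u\<^sup>2 - 2 * u * w \<le> (w - u)\<^sup>2" by (simp add: power2_diff)
    moreover have "max 0 u = u \<or> max 0 u = 0" by (auto simp: max_def)
    ultimately show ?thesis by auto
  qed
  ultimately show "\<bar>(max 0 w)\<^sup>2 - (max 0 u)\<^sup>2 - 2 * max 0 u * (w - u)\<bar> \<le> (norm (w - u))\<^sup>2"
    unfolding e by simp
qed (rule bounded_linear_mult_right)

section \<open>A continuously differentiable bump around M\<close>

locale dist_sq =
  fixes M :: "'a::euclidean_space set" and \<delta> :: real
  assumes M: "compact M" "convex M" "M \<noteq> {}" and \<delta>: "\<delta> > 0"
begin

definition resid :: "'a \<Rightarrow> 'a" where "resid x = x - closest_point M x"
definition D :: "'a \<Rightarrow> real" where "D x = resid x \<bullet> resid x"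
text \<open>Both squares serve smoothness: the squared distance is differentiable across the
  boundary of M, and squaring the positive part removes the kink where D reaches \<delta>
  squared.\<close>

definition bump :: "'a \<Rightarrow> real" where "bump x = (max 0 (1 - D x / \<delta>\<^sup>2))\<^sup>2"
text \<open>The gradient of \<open>bump\<close>. The coefficient 4 is the product of the 2 from the
  outer square and the 2 from the gradient of D.\<close>

definition grad :: "'a \<Rightarrow> 'a" where "grad x = (- 4 / \<delta>\<^sup>2 * max 0 (1 - D x / \<delta>\<^sup>2)) *\<^sub>R resid x"

lemma clM: "closed M" using M by (simp add: compact_imp_closed)

text \<open>
  \<open>D\<close> is convex with gradient \<open>2 *\<^sub>R resid\<close>.
\<close>

lemma D_lower: "D y - D x - 2 * (resid x \<bullet> (y - x)) \<ge> 0"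
proof -
  define c where "c = closest_point M y - closest_point M x"
  \<comment> \<open>The obtuse angle property of the nearest point in a convex set.\<close>
  have "resid x \<bullet> c \<le> 0" unfolding c_def resid_def
    using closest_point_dot[OF M(2) clM closest_point_in_set[OF clM M(3)]] .
  moreover have "y - x = resid y - resid x + c" by (simp add: c_def resid_def)
  then have "D y - D x - 2 * (resid x \<bullet> (y - x)) = (resid y - resid x) \<bullet> (resid y - resid x) - 2 * (resid x \<bullet> c)"
    by (simp add: D_def inner_add_right inner_diff_right inner_diff_left inner_commute)
  ultimately show ?thesis by (metis diff_ge_0_iff_ge inner_ge_zero mult_nonneg_nonpos order_trans zero_le_numeral)
qed

lemma D_le: "D y \<le> (y - z) \<bullet> (y - z)" if "z \<in> M"
  using closest_point_le[OF clM that, of y] unfolding D_def resid_def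
  by (simp add: dist_norm norm_le)

text \<open>The nearest point to x is a competitor for y, which gives the quadratic upper bound; the
  lower bound is convexity.\<close>

lemma D_derivative: "(D has_derivative (\<lambda>h. 2 * (resid x \<bullet> h))) (at x)"
proof (rule has_derivative_quadratic_bound)
  fix y
  have "D y \<le> (resid x + (y - x)) \<bullet> (resid x + (y - x))"
    using D_le[OF closest_point_in_set[OF clM M(3)], of y x] by (simp add: resid_def)
  also have "\<dots> = D x + 2 * (resid x \<bullet> (y - x)) + (norm (y - x))\<^sup>2"
    by (simp add: D_def power2_norm_eq_inner inner_add_left inner_add_right inner_commute)
  finally show "\<bar>D y - D x - 2 * (resid x \<bullet> (y - x))\<bar> \<le> (norm (y - x))\<^sup>2"
    using D_lower[of y x] by simp
qed (intro bounded_linear_intros)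

lemma DERIV_D_line: "((\<lambda>s. D (y + s *\<^sub>R \<theta>)) has_real_derivative 2 * (resid (y + s *\<^sub>R \<theta>) \<bullet> \<theta>)) (at s)"
proof -
  have "((\<lambda>s. D (y + s *\<^sub>R \<theta>)) has_derivative (\<lambda>h. 2 * (resid (y + s *\<^sub>R \<theta>) \<bullet> (h *\<^sub>R \<theta>)))) (at s)"
    by (rule has_derivative_compose[OF _ D_derivative]) (auto intro!: derivative_eq_intros)
  then show ?thesis unfolding has_field_derivative_def
    by (rule has_derivative_eq_rhs) (auto simp: fun_eq_iff)
qed

lemma DERIV_bump_line: "((\<lambda>s. bump (y + s *\<^sub>R \<theta>)) has_real_derivative (grad (y + s *\<^sub>R \<theta>) \<bullet> \<theta>)) (at s)"
proof -
  let ?D = "\<lambda>s. D (y + s *\<^sub>R \<theta>)"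
  have "((\<lambda>s. 1 - ?D s / \<delta>\<^sup>2) has_real_derivative (0 - 2 * (resid (y + s *\<^sub>R \<theta>) \<bullet> \<theta>) / \<delta>\<^sup>2)) (at s)"
    by (intro DERIV_diff DERIV_const DERIV_cdivide DERIV_D_line)
  from DERIV_chain2[OF DERIV_power2_pos_part this] show ?thesis
    unfolding bump_def grad_def by (rule DERIV_cong) simp
qed

lemma continuous_on_resid: "continuous_on A resid"
  unfolding resid_def using M(2,3) clM by (intro continuous_intros continuous_on_closest_point)

lemma continuous_on_D: "continuous_on A D"
  unfolding D_def by (intro continuous_intros continuous_on_resid)

lemma continuous_on_grad: "continuous_on A grad"
  unfolding grad_def using \<delta> by (intro continuous_intros continuous_on_resid continuous_on_D) auto

lemma D_nonneg: "D x \<ge> 0" by (simp add: D_def)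

lemma D_zero: "x \<in> M \<Longrightarrow> D x = 0" by (simp add: D_def resid_def closest_point_self)

lemma D_less_imp: "D x < \<delta>\<^sup>2 \<Longrightarrow> x \<in> M + cball 0 \<delta>"
proof -
  assume "D x < \<delta>\<^sup>2"
  then have "(norm (resid x))\<^sup>2 < \<delta>\<^sup>2" by (simp add: D_def power2_norm_eq_inner)
  then have "norm (resid x) < \<delta>" using \<delta> by (simp add: power_less_imp_less_base)
  then have "closest_point M x + resid x \<in> M + cball 0 \<delta>"
    using closest_point_in_set[OF clM M(3)] by (intro set_plus_intro) auto
  then show ?thesis by (simp add: resid_def)
qed

lemma grad_eq_0: "D x \<ge> \<delta>\<^sup>2 \<Longrightarrow> grad x = 0" and bump_eq_0: "D x \<ge> \<delta>\<^sup>2 \<Longrightarrow> bump x = 0"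
  using \<delta> by (auto simp: grad_def bump_def max_def field_simps)

lemma D_less_bounded: obtains R where "R > 0" "\<And>x. D x \<le> \<delta>\<^sup>2 \<Longrightarrow> norm x \<le> R"
proof -
  obtain R0 where R0: "R0 > 0" "\<And>x. x \<in> M \<Longrightarrow> norm x \<le> R0" using compact_imp_bounded[OF M(1)] bounded_pos by blast
  have "norm x \<le> R0 + \<delta>" if "D x \<le> \<delta>\<^sup>2" for x
  proof -
    have "(norm (resid x))\<^sup>2 \<le> \<delta>\<^sup>2" using that by (simp add: D_def power2_norm_eq_inner)
    then have "norm (resid x) \<le> \<delta>" by (rule power2_le_imp_le) (use \<delta> in simp)
    moreover have "norm (closest_point M x) \<le> R0" by (rule R0(2)[OF closest_point_in_set[OF clM M(3)]])
    ultimately show ?thesis using norm_triangle_ineq[of "closest_point M x" "resid x"] by (simp add: resid_def)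
  qed
  then show thesis using that[of "R0 + \<delta>"] R0 \<delta> by simp
qed

text \<open>
  On a line the bump increases up to the minimizer \<open>s0\<close> of \<open>D\<close> and decreases after it, so the
  variation is twice the maximum.
\<close>

lemma grad_line_integral:
  assumes \<theta>: "norm \<theta> = 1" and meets: "D (y + s1 *\<^sub>R \<theta>) < \<delta>\<^sup>2"
  obtains s0 where "(\<integral>\<^sup>+s. ennreal \<bar>grad (y + s *\<^sub>R \<theta>) \<bullet> \<theta>\<bar> \<partial>lborel) = ennreal (2 * bump (y + s0 *\<^sub>R \<theta>))"
    "\<And>s. D (y + s0 *\<^sub>R \<theta>) \<le> D (y + s *\<^sub>R \<theta>)"
proof -
  let ?q = "\<lambda>s. D (y + s *\<^sub>R \<theta>)" and ?q' = "\<lambda>s. 2 * (resid (y + s *\<^sub>R \<theta>) \<bullet> \<theta>)"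
  let ?g = "\<lambda>s. bump (y + s *\<^sub>R \<theta>)" and ?g' = "\<lambda>s. grad (y + s *\<^sub>R \<theta>) \<bullet> \<theta>"
  obtain R0 where R0: "R0 > 0" "\<And>x. D x \<le> \<delta>\<^sup>2 \<Longrightarrow> norm x \<le> R0" using D_less_bounded by metis
  \<comment> \<open>As \<theta> is a unit vector, a parameter of size at least R leaves the region
    where D is at most \<delta> squared; the added 1 makes this strict.\<close>
  define R where "R = R0 + norm y + 1"
  have Rpos: "R > 0" using R0 by (simp add: R_def add_nonneg_pos)
  have far: "?q s > \<delta>\<^sup>2" if "\<bar>s\<bar> \<ge> R" for s
  proof (rule ccontr)
    assume "\<not> ?thesis"
    then have "norm (y + s *\<^sub>R \<theta>) \<le> R0" using R0 by simp
    moreover have "\<bar>s\<bar> \<le> norm (y + s *\<^sub>R \<theta>) + norm y"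
      using norm_triangle_ineq4[of "y + s *\<^sub>R \<theta>" y] \<theta> by simp
    ultimately show False using that by (simp add: R_def)
  qed
  have "continuous_on {-R..R} ?q"
    by (rule continuous_on_compose2[OF continuous_on_D[of UNIV]]) (auto intro!: continuous_intros)
  then obtain s0 where s0: "s0 \<in> {-R..R}" "\<And>s. s \<in> {-R..R} \<Longrightarrow> ?q s0 \<le> ?q s"
    using continuous_attains_inf[of "{-R..R}" ?q] Rpos by auto
  have s1: "s1 \<in> {-R..R}"
  proof (rule ccontr)
    assume "s1 \<notin> {-R..R}"
    then have "R \<le> \<bar>s1\<bar>" by auto
    from far[OF this] meets show False by simp
  qed
  have min: "?q s0 \<le> ?q s" for s
  proof (cases "s \<in> {-R..R}")
    case False
    then have "\<bar>s\<bar> \<ge> R" by auto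
    then show ?thesis using far[of s] s0(2)[OF s1] meets by linarith
  qed (use s0 in auto)
  have q0: "?q' s0 = 0"
    by (rule DERIV_local_min[OF DERIV_D_line, of 1]) (use min in auto)
  have mono: "?q' s \<le> ?q' u" if "s \<le> u" for s u
  proof (cases "s = u")
    case False
    have "0 \<le> ?q u - ?q s - 2 * (resid (y + s *\<^sub>R \<theta>) \<bullet> ((y + u *\<^sub>R \<theta>) - (y + s *\<^sub>R \<theta>)))" by (rule D_lower)
    moreover have "0 \<le> ?q s - ?q u - 2 * (resid (y + u *\<^sub>R \<theta>) \<bullet> ((y + s *\<^sub>R \<theta>) - (y + u *\<^sub>R \<theta>)))" by (rule D_lower)
    ultimately have "0 \<le> (u - s) * (?q' u - ?q' s)"
      by (simp add: inner_diff_right inner_add_right algebra_simps)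
    then show ?thesis using that False by (simp add: zero_le_mult_iff)
  qed simp
  \<comment> \<open>The slope of the bump is a nonpositive multiple of the slope of D, which is
    monotone and vanishes at s0; this fixes its sign on either side.\<close>
  have g': "?g' s = - (2 / \<delta>\<^sup>2 * max 0 (1 - ?q s / \<delta>\<^sup>2)) * ?q' s" for s by (simp add: grad_def)
  have left: "?g' s \<ge> 0" if "s \<le> s0" for s
    unfolding g' using mono[OF that] q0 by (intro mult_nonpos_nonpos) auto
  have right: "?g' s \<le> 0" if "s \<ge> s0" for s
    unfolding g' using mono[OF that] q0 by (intro mult_nonpos_nonneg) auto
  have g0: "?g' s0 = 0" unfolding g' q0 by simp
  have cont: "continuous_on UNIV ?g'"
    by (intro continuous_intros continuous_on_compose2[OF continuous_on_grad[of UNIV]]) auto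
  then have [measurable]: "?g' \<in> borel_measurable borel" by (rule borel_measurable_continuous_onI)
  \<comment> \<open>Both indicators contain s0, which does no harm because the slope is 0 there;
    outside [-R, R] the slope is 0 as well.\<close>
  have split: "ennreal \<bar>?g' s\<bar> = ennreal (?g' s) * indicator {-R..s0} s + ennreal (- ?g' s) * indicator {s0..R} s" for s
  proof (cases "s \<in> {-R..R}")
    case True
    then show ?thesis using left[of s] right[of s] g0
      by (cases s s0 rule: linorder_cases) (auto simp: indicator_def)
  next
    case False
    then have "\<bar>s\<bar> \<ge> R" by auto
    then have "?g' s = 0" using far[of s] grad_eq_0 by auto
    then show ?thesis by simp
  qed
  have z: "?g (-R) = 0" "?g R = 0" using far[of R] far[of "-R"] Rpos bump_eq_0 by (auto simp: less_imp_le)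
  have "(\<integral>\<^sup>+s. ennreal \<bar>?g' s\<bar> \<partial>lborel) =
      (\<integral>\<^sup>+s. ennreal (?g' s) * indicator {-R..s0} s \<partial>lborel) + (\<integral>\<^sup>+s. ennreal (- ?g' s) * indicator {s0..R} s \<partial>lborel)"
    unfolding split by (rule nn_integral_add) measurable
  also have "(\<integral>\<^sup>+s. ennreal (?g' s) * indicator {-R..s0} s \<partial>lborel) = ?g s0 - ?g (-R)"
    by (rule nn_integral_FTC_Icc) (use s0 left DERIV_bump_line in \<open>auto intro: has_vector_derivative_at_within simp flip: has_real_derivative_iff_has_vector_derivative\<close>)
  also have "(\<integral>\<^sup>+s. ennreal (- ?g' s) * indicator {s0..R} s \<partial>lborel) = - ?g R - (- ?g s0)"
    by (rule nn_integral_FTC_Icc) (use s0 right DERIV_bump_line in \<open>auto intro!: DERIV_minus intro: has_vector_derivative_at_within simp flip: has_real_derivative_iff_has_vector_derivative\<close>)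
  finally have "(\<integral>\<^sup>+s. ennreal \<bar>?g' s\<bar> \<partial>lborel) = ennreal (2 * ?g s0)"
    unfolding z by (simp add: bump_def flip: ennreal_plus)
  then show thesis using that min by blast
qed

text \<open>By \<open>grad_line_integral\<close> a line contributes twice the maximum of the bump on
  it: exactly 2 if it meets M, at most 2 if it meets the neighbourhood, and 0 otherwise. Integrating
  over the hyperplane compares this with the two projections.\<close>

lemma grad_integral_bounds:
  assumes \<theta>: "norm \<theta> = 1"
  shows "ennreal (2 * proj_vol M \<theta>) \<le> (\<integral>\<^sup>+x. ennreal \<bar>grad x \<bullet> \<theta>\<bar> \<partial>lborel)"
    and "(\<integral>\<^sup>+x. ennreal \<bar>grad x \<bullet> \<theta>\<bar> \<partial>lborel) \<le> ennreal (2 * proj_vol (M + cball 0 \<delta>) \<theta>)"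
proof -
  let ?N = "lborel_subspace ({\<theta>}\<^sup>\<bottom>)" and ?C = "M + cball 0 \<delta>"
  let ?I = "\<lambda>y. \<integral>\<^sup>+s. ennreal \<bar>grad (y + s *\<^sub>R \<theta>) \<bullet> \<theta>\<bar> \<partial>lborel"
  have cC: "compact ?C" using M by (intro compact_set_plus) auto
  have [measurable]: "grad \<in> borel_measurable borel"
    by (rule borel_measurable_continuous_onI[OF continuous_on_grad])
  have e: "(\<integral>\<^sup>+x. ennreal \<bar>grad x \<bullet> \<theta>\<bar> \<partial>lborel) = (\<integral>\<^sup>+y. ?I y \<partial>?N)"
    by (rule nn_integral_slices[OF \<theta>]) measurable
  have ind: "(\<integral>\<^sup>+y. 2 * indicator (proj_perp \<theta> A) y \<partial>?N) = ennreal (2 * proj_vol A \<theta>)" if "compact A" for A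
  proof -
    have "(\<integral>\<^sup>+y. 2 * indicator (proj_perp \<theta> A) y \<partial>?N) = 2 * emeasure ?N (proj_perp \<theta> A)"
      by (rule nn_integral_cmult_indicator) (use borel_proj_perp[OF that] in simp)
    also have "emeasure ?N (proj_perp \<theta> A) = ennreal (proj_vol A \<theta>)"
      unfolding proj_vol_def using fmeasurable_proj_perp[OF that \<theta>] by (simp add: emeasure_eq_measure2)
    finally show ?thesis by (simp add: ennreal_mult')
  qed
  have lo: "2 * indicator (proj_perp \<theta> M) y \<le> ?I y" and hi: "?I y \<le> 2 * indicator (proj_perp \<theta> ?C) y"
    if y: "y \<bullet> \<theta> = 0" for y
  proof -
    show "2 * indicator (proj_perp \<theta> M) y \<le> ?I y"
    proof (cases "y \<in> proj_perp \<theta> M")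
      case True
      then obtain s1 where "y + s1 *\<^sub>R \<theta> \<in> M" using proj_perp_iff[OF \<theta> y] by blast
      then have s1: "D (y + s1 *\<^sub>R \<theta>) = 0" by (rule D_zero)
      then obtain s0 where s0: "?I y = ennreal (2 * bump (y + s0 *\<^sub>R \<theta>))" "\<And>s. D (y + s0 *\<^sub>R \<theta>) \<le> D (y + s *\<^sub>R \<theta>)"
        using grad_line_integral[OF \<theta>, of y s1] \<delta> by auto
      have "D (y + s0 *\<^sub>R \<theta>) = 0" using s0(2)[of s1] s1 D_nonneg[of "y + s0 *\<^sub>R \<theta>"] by simp
      then have "bump (y + s0 *\<^sub>R \<theta>) = 1" by (simp add: bump_def)
      then show ?thesis using s0(1) True by simp
    qed simp
    show "?I y \<le> 2 * indicator (proj_perp \<theta> ?C) y"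
    proof (cases "\<exists>s1. D (y + s1 *\<^sub>R \<theta>) < \<delta>\<^sup>2")
      case True
      then obtain s1 where s1: "D (y + s1 *\<^sub>R \<theta>) < \<delta>\<^sup>2" ..
      then obtain s0 where s0: "?I y = ennreal (2 * bump (y + s0 *\<^sub>R \<theta>))"
        using grad_line_integral[OF \<theta>, of y s1] by metis
      have "y \<in> proj_perp \<theta> ?C" using proj_perp_iff[OF \<theta> y] D_less_imp[OF s1] by blast
      moreover have "bump (y + s0 *\<^sub>R \<theta>) \<le> 1"
        unfolding bump_def using D_nonneg[of "y + s0 *\<^sub>R \<theta>"] \<delta> by (intro power_le_one) auto
      then have "ennreal (2 * bump (y + s0 *\<^sub>R \<theta>)) \<le> ennreal 2" by (intro ennreal_leI) simp
      ultimately show ?thesis using s0 by simp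
    next
      case False
      then have "grad (y + s *\<^sub>R \<theta>) = 0" for s by (intro grad_eq_0) (simp add: not_less)
      then show ?thesis by simp
    qed
  qed
  show "ennreal (2 * proj_vol M \<theta>) \<le> (\<integral>\<^sup>+x. ennreal \<bar>grad x \<bullet> \<theta>\<bar> \<partial>lborel)"
    unfolding e ind[OF M(1), symmetric]
    by (rule nn_integral_mono_AE) (use AE_lborel_subspace[OF \<theta>] lo in \<open>auto elim!: eventually_mono\<close>)
  show "(\<integral>\<^sup>+x. ennreal \<bar>grad x \<bullet> \<theta>\<bar> \<partial>lborel) \<le> ennreal (2 * proj_vol ?C \<theta>)"
    unfolding e ind[OF cC, symmetric]
    by (rule nn_integral_mono_AE) (use AE_lborel_subspace[OF \<theta>] hi in \<open>auto elim!: eventually_mono\<close>)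
qed

lemma integrable_grad: "integrable lborel grad"
proof -
  obtain R where R: "R > 0" "\<And>x. D x \<le> \<delta>\<^sup>2 \<Longrightarrow> norm x \<le> R" using D_less_bounded by metis
  have "integrable lborel (\<lambda>x. indicator (cball 0 R) x *\<^sub>R grad x)"
    by (rule borel_integrable_compact) (auto intro: continuous_on_grad)
  moreover have "indicator (cball 0 R) x *\<^sub>R grad x = grad x" for x
  proof (cases "norm x \<le> R")
    case False
    then have "D x > \<delta>\<^sup>2" using R(2)[of x] by linarith
    then show ?thesis using grad_eq_0[of x] by simp
  qed simp
  ultimately show ?thesis by simp
qed

end

section \<open>Discretizing the gradient field\<close>

lemma ex_list_approx_integral:
  fixes G :: "'a::euclidean_space \<Rightarrow> 'a"
  assumes G: "integrable lborel G" and "\<eta> > 0"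
  obtains vs where "\<And>\<theta>. norm \<theta> = 1 \<Longrightarrow> \<bar>2 * (\<Sum>v\<leftarrow>vs. \<bar>v \<bullet> \<theta>\<bar>) - (\<integral>x. \<bar>G x \<bullet> \<theta>\<bar> \<partial>lborel)\<bar> \<le> \<eta>"
proof -
  obtain x0 where "has_bochner_integral lborel G x0" using G by (auto simp: integrable.simps)
  then obtain S where S: "\<And>i. Bochner_Integration.simple_bochner_integrable lborel (S i)"
    "(\<lambda>i. \<integral>\<^sup>+x. norm (G x - S i x) \<partial>lborel) \<longlonglongrightarrow> 0"
    by (rule has_bochner_integral.cases) blast
  have "\<forall>\<^sub>F i in sequentially. (\<integral>\<^sup>+x. norm (G x - S i x) \<partial>lborel) < ennreal \<eta>"
    using order_tendstoD(2)[OF S(2)] \<open>\<eta> > 0\<close> by simp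
  then obtain i where i: "(\<integral>\<^sup>+x. norm (G x - S i x) \<partial>lborel) < ennreal \<eta>"
    by (auto simp: eventually_sequentially)
  define s where "s = S i"
  have s: "Bochner_Integration.simple_bochner_integrable lborel s" unfolding s_def by (rule S)
  then have sf: "simple_function lborel s" and fin: "finite (range s)"
    by (auto simp: simple_bochner_integrable.simps dest: simple_functionD)
  have ints: "integrable lborel s"
    using has_bochner_integral_simple_bochner_integrable[OF s] by (auto simp: integrable.simps)
  obtain ys where ys: "set ys = range s" "distinct ys" using finite_distinct_list[OF fin] by blast
  \<comment> \<open>One generator per value of s, halved because the segment from -v to v has length
    2 |v|. The value 0, whose level set has infinite volume, contributes the zero vector.\<close>
  define vs where "vs = map (\<lambda>y. (measure lborel {x. s x = y} / 2) *\<^sub>R y) ys"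
  show thesis
  proof (rule that[of vs])
    fix \<theta> :: 'a assume \<theta>: "norm \<theta> = 1"
    have sb: "Bochner_Integration.simple_bochner_integrable lborel (\<lambda>x. \<bar>s x \<bullet> \<theta>\<bar>)"
      by (rule simple_bochner_integrable_compose2[where p="\<lambda>u v. \<bar>u \<bullet> \<theta>\<bar>", OF _ s s]) simp
    have "(\<integral>x. \<bar>s x \<bullet> \<theta>\<bar> \<partial>lborel) = Bochner_Integration.simple_bochner_integral lborel (\<lambda>x. \<bar>s x \<bullet> \<theta>\<bar>)"
      by (rule simple_bochner_integrable_eq_integral[OF sb, symmetric])
    also have "\<dots> = (\<Sum>y\<in>s ` space lborel. measure lborel {x\<in>space lborel. s x = y} *\<^sub>R \<bar>y \<bullet> \<theta>\<bar>)"
      by (rule simple_bochner_integral_partition[OF sb sf]) auto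
    also have "\<dots> = (\<Sum>y\<leftarrow>ys. measure lborel {x. s x = y} * \<bar>y \<bullet> \<theta>\<bar>)"
      using ys by (simp add: sum_list_distinct_conv_sum_set)
    also have "\<dots> = 2 * (\<Sum>v\<leftarrow>vs. \<bar>v \<bullet> \<theta>\<bar>)"
      unfolding vs_def by (induction ys) (simp_all add: abs_mult)
    finally have 1: "2 * (\<Sum>v\<leftarrow>vs. \<bar>v \<bullet> \<theta>\<bar>) = (\<integral>x. \<bar>s x \<bullet> \<theta>\<bar> \<partial>lborel)" ..
    have "\<bar>(\<integral>x. \<bar>s x \<bullet> \<theta>\<bar> \<partial>lborel) - (\<integral>x. \<bar>G x \<bullet> \<theta>\<bar> \<partial>lborel)\<bar> = \<bar>\<integral>x. \<bar>s x \<bullet> \<theta>\<bar> - \<bar>G x \<bullet> \<theta>\<bar> \<partial>lborel\<bar>"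
      using ints G by (subst Bochner_Integration.integral_diff) auto
    also have "\<dots> \<le> (\<integral>x. \<bar>\<bar>s x \<bullet> \<theta>\<bar> - \<bar>G x \<bullet> \<theta>\<bar>\<bar> \<partial>lborel)"
      by (rule integral_abs_bound)
    \<comment> \<open>The map taking u to the absolute value of its product with a unit vector is
      1-Lipschitz, so a single L1 approximation of G serves all directions at once.\<close>
    also have "\<dots> \<le> (\<integral>x. norm (G x - s x) \<partial>lborel)"
    proof (rule integral_mono)
      fix x
      have "\<bar>\<bar>s x \<bullet> \<theta>\<bar> - \<bar>G x \<bullet> \<theta>\<bar>\<bar> \<le> \<bar>(G x - s x) \<bullet> \<theta>\<bar>" by (simp add: inner_diff_left)
      also have "\<dots> \<le> norm (G x - s x)" using Cauchy_Schwarz_ineq2[of "G x - s x" \<theta>] \<theta> by simp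
      finally show "\<bar>\<bar>s x \<bullet> \<theta>\<bar> - \<bar>G x \<bullet> \<theta>\<bar>\<bar> \<le> norm (G x - s x)" .
    qed (use ints G in auto)
    also have "\<dots> \<le> \<eta>"
    proof -
      have "ennreal (\<integral>x. norm (G x - s x) \<partial>lborel) = (\<integral>\<^sup>+x. norm (G x - s x) \<partial>lborel)"
        using ints G by (intro nn_integral_eq_integral[symmetric]) auto
      then have "ennreal (\<integral>x. norm (G x - s x) \<partial>lborel) \<le> ennreal \<eta>" using i by (simp add: s_def)
      then show ?thesis using \<open>\<eta> > 0\<close> by (simp add: ennreal_le_iff)
    qed
    finally show "\<bar>2 * (\<Sum>v\<leftarrow>vs. \<bar>v \<bullet> \<theta>\<bar>) - (\<integral>x. \<bar>G x \<bullet> \<theta>\<bar> \<partial>lborel)\<bar> \<le> \<eta>" unfolding 1 .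
  qed
qed

lemma ex_list_approx_proj_vol:
  fixes M :: "'a::euclidean_space set"
  assumes M: "convex_body M" "0 \<in> interior M" and \<eta>: "\<eta> > 0"
  obtains vs where "\<And>\<theta>. norm \<theta> = 1 \<Longrightarrow> proj_vol M \<theta> - \<eta> \<le> (\<Sum>v\<leftarrow>vs. \<bar>v \<bullet> \<theta>\<bar>)"
    "\<And>\<theta>. norm \<theta> = 1 \<Longrightarrow> (\<Sum>v\<leftarrow>vs. \<bar>v \<bullet> \<theta>\<bar>) \<le> (1 + \<eta>) ^ (DIM('a) - 1) * proj_vol M \<theta> + \<eta>"
proof -
  have cM: "compact M" "convex M" "M \<noteq> {}" using M interior_subset by (auto simp: convex_body_def)
  obtain e where e: "e > 0" "cball 0 e \<subseteq> M" using M(2) by (auto simp: mem_interior_cball)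
  \<comment> \<open>With \<delta> = \<eta> e the neighbourhood of M fits into the dilate of M by 1 +
    \<eta>, whose projection volumes are known by scaling.\<close>
  interpret dist_sq M "\<eta> * e" by unfold_locales (use cM e \<eta> in auto)
  have "cball 0 (\<eta> * e) \<subseteq> (*\<^sub>R) \<eta> ` M"
  proof
    fix x :: 'a assume "x \<in> cball 0 (\<eta> * e)"
    then have "(1 / \<eta>) *\<^sub>R x \<in> cball 0 e" using \<eta> by (simp add: field_simps)
    then have "\<eta> *\<^sub>R ((1 / \<eta>) *\<^sub>R x) \<in> (*\<^sub>R) \<eta> ` M" using e by blast
    then show "x \<in> (*\<^sub>R) \<eta> ` M" using \<eta> by simp
  qed
  then have "M + cball 0 (\<eta> * e) \<subseteq> M + (*\<^sub>R) \<eta> ` M" by (intro set_plus_mono2) auto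
  then have sub: "M + cball 0 (\<eta> * e) \<subseteq> (*\<^sub>R) (1 + \<eta>) ` M"
    using scaleR_add_image_subset[OF cM(2), of \<eta>] \<eta> by simp
  obtain vs where vs: "\<And>\<theta>. norm \<theta> = 1 \<Longrightarrow> \<bar>2 * (\<Sum>v\<leftarrow>vs. \<bar>v \<bullet> \<theta>\<bar>) - (\<integral>x. \<bar>grad x \<bullet> \<theta>\<bar> \<partial>lborel)\<bar> \<le> 2 * \<eta>"
    using ex_list_approx_integral[OF integrable_grad, of "2 * \<eta>"] \<eta> by auto
  show thesis
  proof (rule that[of vs])
    fix \<theta> :: 'a assume \<theta>: "norm \<theta> = 1"
    have int: "(\<integral>\<^sup>+x. ennreal \<bar>grad x \<bullet> \<theta>\<bar> \<partial>lborel) = ennreal (\<integral>x. \<bar>grad x \<bullet> \<theta>\<bar> \<partial>lborel)"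
      using integrable_grad by (intro nn_integral_eq_integral) auto
    have nn: "0 \<le> (\<integral>x. \<bar>grad x \<bullet> \<theta>\<bar> \<partial>lborel)" by simp
    have "2 * proj_vol M \<theta> \<le> (\<integral>x. \<bar>grad x \<bullet> \<theta>\<bar> \<partial>lborel)"
      using grad_integral_bounds(1)[OF \<theta>] nn unfolding int by (simp add: ennreal_le_iff)
    then show "proj_vol M \<theta> - \<eta> \<le> (\<Sum>v\<leftarrow>vs. \<bar>v \<bullet> \<theta>\<bar>)" using vs[OF \<theta>] by linarith
    have pd: "proj_vol_dir A \<theta> = proj_vol A \<theta>" for A using \<theta> by (simp add: proj_vol_dir_def)
    have "(\<integral>x. \<bar>grad x \<bullet> \<theta>\<bar> \<partial>lborel) \<le> 2 * proj_vol (M + cball 0 (\<eta> * e)) \<theta>"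
      using grad_integral_bounds(2)[OF \<theta>] unfolding int by (simp add: ennreal_le_iff proj_vol_def)
    also have "proj_vol (M + cball 0 (\<eta> * e)) \<theta> \<le> proj_vol ((*\<^sub>R) (1 + \<eta>) ` M) \<theta>"
      using cM by (intro proj_vol_mono sub \<theta> compact_set_plus compact_scaling) auto
    also have "\<dots> = (1 + \<eta>) ^ (DIM('a) - 1) * proj_vol M \<theta>"
      using proj_vol_dir_scaleR_image[OF cM(1,2), of "1 + \<eta>" \<theta>] \<eta> unfolding pd by simp
    finally show "(\<Sum>v\<leftarrow>vs. \<bar>v \<bullet> \<theta>\<bar>) \<le> (1 + \<eta>) ^ (DIM('a) - 1) * proj_vol M \<theta> + \<eta>"
      using vs[OF \<theta>] by linarith
  qed
qed

section \<open>Comparison of support functions\<close>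

lemma zero_in_interior:
  assumes "convex_body K" "origin_symmetric K"
  shows "0 \<in> interior K"
proof -
  obtain x where x: "x \<in> interior K" using assms(1) by (auto simp: convex_body_def)
  then have "- x \<in> interior K"
    using assms(2) interior_negations[of K] unfolding origin_symmetric_def by (metis imageI)
  then have "(1/2) *\<^sub>R x + (1/2) *\<^sub>R (- x) \<in> interior K"
    using x assms(1) by (intro convexD convex_interior) (auto simp: convex_body_def)
  then show ?thesis by simp
qed

text \<open>With \<open>zonotope_inner_attained\<close> this identifies the support function of a
  zonotope, the quantity approximated above.\<close>

lemma zonotope_inner_le: "x \<in> zonotope vs \<Longrightarrow> x \<bullet> \<theta> \<le> (\<Sum>v\<leftarrow>vs. \<bar>v \<bullet> \<theta>\<bar>)"
  for \<theta> :: "'a::real_inner"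
proof (induction vs arbitrary: x)
  case (Cons v vs)
  then obtain y z where yz: "x = y + z" "y \<in> closed_segment (- v) v" "z \<in> zonotope vs"
    by (auto elim!: set_plus_elim)
  then obtain u where u: "0 \<le> u" "u \<le> 1" "y = (1 - u) *\<^sub>R (- v) + u *\<^sub>R v" by (auto simp: in_segment)
  then have "y = (2 * u - 1) *\<^sub>R v" by (simp add: algebra_simps flip: scaleR_2)
  then have "\<bar>y \<bullet> \<theta>\<bar> = \<bar>2 * u - 1\<bar> * \<bar>v \<bullet> \<theta>\<bar>" by (simp add: abs_mult)
  also have "\<dots> \<le> 1 * \<bar>v \<bullet> \<theta>\<bar>" using u by (intro mult_right_mono) auto
  finally show ?case using Cons.IH[OF yz(3)] yz(1) by (simp add: inner_add_left)
qed simp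

lemma zonotope_inner_attained: "\<exists>x\<in>zonotope vs. x \<bullet> \<theta> = (\<Sum>v\<leftarrow>vs. \<bar>v \<bullet> \<theta>\<bar>)"
  for \<theta> :: "'a::real_inner"
proof (induction vs)
  case (Cons v vs)
  then obtain z where z: "z \<in> zonotope vs" "z \<bullet> \<theta> = (\<Sum>v\<leftarrow>vs. \<bar>v \<bullet> \<theta>\<bar>)" by blast
  define y where "y = (if v \<bullet> \<theta> \<ge> 0 then v else - v)"
  have "y \<in> closed_segment (- v) v" by (simp add: y_def)
  then have "y + z \<in> zonotope (v # vs)" using set_plus_intro[OF _ z(1)] by simp
  moreover have "(y + z) \<bullet> \<theta> = (\<Sum>v\<leftarrow>v # vs. \<bar>v \<bullet> \<theta>\<bar>)" by (simp add: y_def inner_add_left z)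
  ultimately show ?case by blast
qed simp

text \<open>Separation of a point from B. The hypothesis asks for a point of B dominating A instead
  of comparing suprema, so no boundedness has to be supplied.\<close>

lemma convex_subset_by_support:
  fixes A B :: "'a::euclidean_space set"
  assumes B: "convex B" "closed B"
    and le: "\<And>\<theta>. norm \<theta> = 1 \<Longrightarrow> \<exists>b\<in>B. \<forall>a\<in>A. a \<bullet> \<theta> \<le> b \<bullet> \<theta>"
    and ne: "B \<noteq> {}"
  shows "A \<subseteq> B"
proof
  fix x assume x: "x \<in> A"
  show "x \<in> B"
  proof (rule ccontr)
    assume "x \<notin> B"
    then obtain a c where ac: "a \<bullet> x < c" "\<And>y. y \<in> B \<Longrightarrow> a \<bullet> y > c"
      using separating_hyperplane_closed_point[OF B] by blast
    have a: "a \<noteq> 0" using ac ne by force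
    \<comment> \<open>The separating functional is smaller at x than on B, hence the reversed
      sign.\<close>
    then have "norm ((- 1 / norm a) *\<^sub>R a) = 1" by simp
    then obtain b where b: "b \<in> B" "x \<bullet> ((- 1 / norm a) *\<^sub>R a) \<le> b \<bullet> ((- 1 / norm a) *\<^sub>R a)"
      using le x by blast
    then have "b \<bullet> a \<le> x \<bullet> a" using a by (simp add: divide_le_cancel)
    then show False using ac(1) ac(2)[OF b(1)] by (simp add: inner_commute)
  qed
qed

lemma projection_body_zonotope_approx:
  fixes L :: "'a::euclidean_space set"
  assumes L: "projection_body L" and \<delta>: "0 < \<delta>" "\<delta> < 1"
  obtains vs where "(*\<^sub>R) (1 - \<delta>) ` L \<subseteq> zonotope vs" "zonotope vs \<subseteq> (*\<^sub>R) (1 + \<delta>) ` L"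
proof -
  obtain M where M: "convex_body M" "origin_symmetric M" and LM: "convex_body L" "origin_symmetric L"
    "\<And>\<theta>. norm \<theta> = 1 \<Longrightarrow> support_function L \<theta> = proj_vol M \<theta>"
    using L unfolding projection_body_def is_projection_body_of_def by auto
  have M0: "0 \<in> interior M" and L0: "0 \<in> interior L" using zero_in_interior M LM by blast+
  have cL: "compact L" "convex L" "L \<noteq> {}" using LM(1) interior_subset by (auto simp: convex_body_def)
  obtain e where e: "e > 0" "cball 0 e \<subseteq> L" using L0 by (auto simp: mem_interior_cball)
  let ?h = "proj_vol M"
  have att: "\<exists>y\<in>L. y \<bullet> \<theta> = ?h \<theta> \<and> (\<forall>x\<in>L. x \<bullet> \<theta> \<le> y \<bullet> \<theta>)" if \<theta>: "norm \<theta> = 1" for \<theta>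
  proof -
    have "continuous_on L (\<lambda>x. \<theta> \<bullet> x)" by (intro continuous_intros)
    then obtain y where y: "y \<in> L" "\<And>x. x \<in> L \<Longrightarrow> \<theta> \<bullet> x \<le> \<theta> \<bullet> y"
      using continuous_attains_sup[OF cL(1,3)] by blast
    have "support_function L \<theta> = \<theta> \<bullet> y"
      unfolding support_function_def using y by (intro cSup_eq_maximum) auto
    then show ?thesis using y LM(3)[OF \<theta>] by (auto simp: inner_commute)
  qed
  \<comment> \<open>The uniform positive lower bound converts the additive error \<eta> into a
    multiplicative one.\<close>
  have he: "e \<le> ?h \<theta>" if \<theta>: "norm \<theta> = 1" for \<theta>
  proof -
    obtain y where y: "y \<bullet> \<theta> = ?h \<theta>" "\<forall>x\<in>L. x \<bullet> \<theta> \<le> y \<bullet> \<theta>" using att[OF \<theta>] by blast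
    have "e *\<^sub>R \<theta> \<in> L" using e \<theta> by auto
    then have "(e *\<^sub>R \<theta>) \<bullet> \<theta> \<le> ?h \<theta>" using y by fastforce
    then show ?thesis using \<theta> by (simp add: norm_eq_1)
  qed
  \<comment> \<open>Half of \<delta> absorbs the factor (1 + \<eta>)^(n-1), the other half the
    additive error.\<close>
  have "((\<lambda>\<eta>. (1 + \<eta>) ^ (DIM('a) - 1)) \<longlongrightarrow> (1 + 0) ^ (DIM('a) - 1)) (at_right (0::real))"
    by (intro tendsto_intros)
  then have "\<forall>\<^sub>F \<eta> in at_right (0::real). (1 + \<eta>) ^ (DIM('a) - 1) < 1 + \<delta> / 2"
    using \<delta> by (intro order_tendstoD(2)[of _ "1::real"]) auto
  moreover have "\<forall>\<^sub>F \<eta> in at_right 0. \<eta> < e * \<delta> / 2"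
    using eventually_at_right_real[of 0 "e * \<delta> / 2"] e \<delta> by (auto elim: eventually_mono)
  moreover have "\<forall>\<^sub>F \<eta> in at_right (0::real). \<eta> > 0" by (rule eventually_at_right_less)
  ultimately have "\<forall>\<^sub>F \<eta> in at_right (0::real). (1 + \<eta>) ^ (DIM('a) - 1) < 1 + \<delta> / 2 \<and> \<eta> < e * \<delta> / 2 \<and> \<eta> > 0"
    by eventually_elim simp
  then obtain \<eta> where \<eta>: "(1 + \<eta>) ^ (DIM('a) - 1) < 1 + \<delta> / 2" "\<eta> < e * \<delta> / 2" "\<eta> > 0"
    by (metis (no_types, lifting) eventually_happens trivial_limit_at_right_real)
  obtain vs where vs: "\<And>\<theta>. norm \<theta> = 1 \<Longrightarrow> ?h \<theta> - \<eta> \<le> (\<Sum>v\<leftarrow>vs. \<bar>v \<bullet> \<theta>\<bar>)"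
    "\<And>\<theta>. norm \<theta> = 1 \<Longrightarrow> (\<Sum>v\<leftarrow>vs. \<bar>v \<bullet> \<theta>\<bar>) \<le> (1 + \<eta>) ^ (DIM('a) - 1) * ?h \<theta> + \<eta>"
    using ex_list_approx_proj_vol[OF M(1) M0 \<eta>(3)] by metis
  have \<eta>h: "\<eta> \<le> \<delta> / 2 * ?h \<theta>" if "norm \<theta> = 1" for \<theta>
  proof -
    have "\<delta> / 2 * e \<le> \<delta> / 2 * ?h \<theta>" using he[OF that] \<delta> by (intro mult_left_mono) auto
    then show ?thesis using \<eta>(2) by (simp add: mult.commute)
  qed
  have lo: "(1 - \<delta>) * ?h \<theta> \<le> (\<Sum>v\<leftarrow>vs. \<bar>v \<bullet> \<theta>\<bar>)"
    and hi: "(\<Sum>v\<leftarrow>vs. \<bar>v \<bullet> \<theta>\<bar>) \<le> (1 + \<delta>) * ?h \<theta>" if \<theta>: "norm \<theta> = 1" for \<theta>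
  proof -
    have h: "?h \<theta> > 0" using he[OF \<theta>] e by linarith
    have "\<delta> / 2 * ?h \<theta> \<le> \<delta> * ?h \<theta>" using h \<delta> by simp
    then show "(1 - \<delta>) * ?h \<theta> \<le> (\<Sum>v\<leftarrow>vs. \<bar>v \<bullet> \<theta>\<bar>)"
      using vs(1)[OF \<theta>] \<eta>h[OF \<theta>] by (simp add: left_diff_distrib)
    have "(1 + \<eta>) ^ (DIM('a) - 1) * ?h \<theta> \<le> (1 + \<delta> / 2) * ?h \<theta>"
      using \<eta>(1) h by (intro mult_right_mono) auto
    then show "(\<Sum>v\<leftarrow>vs. \<bar>v \<bullet> \<theta>\<bar>) \<le> (1 + \<delta>) * ?h \<theta>"
      using vs(2)[OF \<theta>] \<eta>h[OF \<theta>] by (simp add: distrib_right)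
  qed
  show thesis
  proof (rule that[of vs])
    show "(*\<^sub>R) (1 - \<delta>) ` L \<subseteq> zonotope vs"
    proof (rule convex_subset_by_support)
      fix \<theta> :: 'a assume \<theta>: "norm \<theta> = 1"
      obtain y where y: "y \<bullet> \<theta> = ?h \<theta>" "\<forall>x\<in>L. x \<bullet> \<theta> \<le> y \<bullet> \<theta>" using att[OF \<theta>] by blast
      obtain z where z: "z \<in> zonotope vs" "z \<bullet> \<theta> = (\<Sum>v\<leftarrow>vs. \<bar>v \<bullet> \<theta>\<bar>)" using zonotope_inner_attained by blast
      have "((1 - \<delta>) *\<^sub>R x) \<bullet> \<theta> \<le> z \<bullet> \<theta>" if "x \<in> L" for x
      proof -
        have "((1 - \<delta>) *\<^sub>R x) \<bullet> \<theta> \<le> (1 - \<delta>) * ?h \<theta>"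
          using y that \<delta> by (simp add: mult_left_mono)
        then show ?thesis using lo[OF \<theta>] z by linarith
      qed
      then show "\<exists>b\<in>zonotope vs. \<forall>a\<in>(*\<^sub>R) (1 - \<delta>) ` L. a \<bullet> \<theta> \<le> b \<bullet> \<theta>" using z(1) by blast
    qed (use convex_zonotope compact_zonotope zero_in_zonotope compact_imp_closed in blast)+
    show "zonotope vs \<subseteq> (*\<^sub>R) (1 + \<delta>) ` L"
    proof (rule convex_subset_by_support)
      fix \<theta> :: 'a assume \<theta>: "norm \<theta> = 1"
      obtain y where y: "y \<in> L" "y \<bullet> \<theta> = ?h \<theta>" using att[OF \<theta>] by blast
      have "x \<bullet> \<theta> \<le> ((1 + \<delta>) *\<^sub>R y) \<bullet> \<theta>" if "x \<in> zonotope vs" for x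
        using zonotope_inner_le[OF that, of \<theta>] hi[OF \<theta>] y(2) by simp
      then show "\<exists>b\<in>(*\<^sub>R) (1 + \<delta>) ` L. \<forall>a\<in>zonotope vs. a \<bullet> \<theta> \<le> b \<bullet> \<theta>" using y(1) by blast
    qed (use cL in \<open>auto intro: convex_scaling compact_scaling compact_imp_closed\<close>)
  qed
qed

lemma divide_root_eq_powr:
  assumes "a > 0" "n > 0"
  shows "a / root n a = a powr ((real n - 1) / real n)"
proof -
  have "a powr ((real n - 1) / real n) = a powr (1 - 1 / real n)" using assms(2) by (simp add: diff_divide_distrib)
  also have "\<dots> = a / root n a" using assms by (simp add: powr_diff root_powr_inverse)
  finally show ?thesis ..
qed

section \<open>The stability inequality\<close>

theorem shephard_stability:
  fixes K L :: "'a::euclidean_space set"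
  assumes \<epsilon>: "\<epsilon> > 0" and K: "convex_body K" "origin_symmetric K" and L: "projection_body L"
    and le: "\<And>\<xi>. norm \<xi> = 1 \<Longrightarrow> proj_vol K \<xi> \<le> proj_vol L \<xi> - \<epsilon>"
  shows "measure lebesgue K powr ((real DIM('a) - 1) / real DIM('a))
       \<le> measure lebesgue L powr ((real DIM('a) - 1) / real DIM('a)) - proj_const DIM('a) * \<epsilon>"
proof -
  let ?n = "DIM('a)"
  define a l where "a = measure lebesgue K" and "l = measure lebesgue L"
  define \<kappa> \<kappa>' where "\<kappa> = unit_ball_vol (real ?n)" and "\<kappa>' = unit_ball_vol (real ?n - 1)"
  have LB: "convex_body L" "origin_symmetric L" using L by (auto simp: projection_body_def is_projection_body_of_def)
  have cL: "compact L" "convex L" using LB by (auto simp: convex_body_def)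
  have al: "a > 0" "l > 0" using measure_pos_convex_body K LB by (auto simp: a_def l_def)
  have \<kappa>: "\<kappa> > 0" "\<kappa>' > 0" by (auto simp: \<kappa>_def \<kappa>'_def intro!: unit_ball_vol_pos)
  have ball: "convex_body (cball 0 1 :: 'a set)" "measure lebesgue (cball 0 1 :: 'a set) = \<kappa>"
    by (auto simp: convex_body_def content_cball \<kappa>_def)
  have dir: "proj_vol_dir K v \<le> proj_vol_dir L v - \<epsilon> * norm v" for v
  proof (cases "v = 0")
    case False
    then have "norm v * proj_vol K (v /\<^sub>R norm v) \<le> norm v * (proj_vol L (v /\<^sub>R norm v) - \<epsilon>)"
      by (intro mult_left_mono le) auto
    then show ?thesis by (simp add: proj_vol_dir_def algebra_simps)
  qed (simp add: proj_vol_dir_def)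
  have main: "?n * ((1 - \<delta>) * (a * root ?n (l / a) + \<epsilon> / \<kappa>' * (\<kappa> * root ?n (l / \<kappa>)))) \<le> ?n * ((1 + \<delta>) * l)"
    if \<delta>: "0 < \<delta>" "\<delta> < 1" for \<delta>
  proof -
    obtain vs where vs: "(*\<^sub>R) (1 - \<delta>) ` L \<subseteq> zonotope vs" "zonotope vs \<subseteq> (*\<^sub>R) (1 + \<delta>) ` L"
      using projection_body_zonotope_approx[OF L \<delta>] by blast
    define z where "z = measure lebesgue (zonotope vs)"
    have cL': "compact ((*\<^sub>R) (1 - \<delta>) ` L)" using cL by (intro compact_scaling)
    have "interior ((*\<^sub>R) (1 - \<delta>) ` L) \<noteq> {}"
      using LB \<delta> by (auto simp: convex_body_def interior_injective_linear_image[OF linear_scaleR] inj_on_def)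
    then have Z: "convex_body (zonotope vs)"
      using interior_mono[OF vs(1)] by (auto simp: convex_body_def compact_zonotope convex_zonotope)
    have "measure lebesgue ((*\<^sub>R) (1 - \<delta>) ` L) \<le> z"
      unfolding z_def by (rule measure_mono_fmeasurable)
        (use vs(1) cL' in \<open>auto intro: lmeasurable_compact compact_zonotope fmeasurableD\<close>)
    then have zl: "(1 - \<delta>) ^ ?n * l \<le> z"
      using measure_scaleR_image[OF cL(1), of "1 - \<delta>"] \<delta> by (simp add: l_def)
    \<comment> \<open>Since Z contains the dilate of L by 1 - \<delta>, its volume can be replaced
      by that of L at the cost of this factor. That removes \<open>vs\<close> before the
      limit.\<close>
    have rz: "(1 - \<delta>) * root ?n (l / b) \<le> root ?n (z / b)" if "b > 0" for b
    proof -
      have "(1 - \<delta>) * root ?n (l / b) = root ?n ((1 - \<delta>) ^ ?n * l / b)"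
        using \<delta> by (simp add: real_root_mult real_root_divide real_root_power_cancel)
      also have "\<dots> \<le> root ?n (z / b)"
        using zl that by (intro real_root_le_mono divide_right_mono) auto
      finally show ?thesis .
    qed
    let ?SN = "\<Sum>v\<leftarrow>vs. norm v" and ?SK = "\<Sum>v\<leftarrow>vs. proj_vol_dir K v" and ?SL = "\<Sum>v\<leftarrow>vs. proj_vol_dir L v"
    have 1: "?n * a * root ?n (z / a) \<le> 2 * ?SK"
      using minkowski_first_zonotope[OF K(1) zero_in_interior[OF K] Z] by (simp add: a_def z_def)
    \<comment> \<open>All projections of the ball have the same volume \<kappa>', so Minkowski's
      inequality bounds the total length of the generators from below; summing the constant gap
      \<epsilon> over directions then yields a definite gain.\<close>
    have "?n * \<kappa> * root ?n (z / \<kappa>) \<le> 2 * (\<Sum>v\<leftarrow>vs. proj_vol_dir (cball 0 1) v)"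
      using minkowski_first_zonotope[OF ball(1) _ Z] unfolding ball(2) z_def by simp
    also have "(\<Sum>v\<leftarrow>vs. proj_vol_dir (cball 0 1) v) = \<kappa>' * ?SN"
      by (simp add: proj_vol_dir_cball sum_list_const_mult \<kappa>'_def)
    finally have 2: "?n * \<kappa> * root ?n (z / \<kappa>) \<le> 2 * (\<kappa>' * ?SN)" .
    have 3: "2 * ?SL \<le> ?n * (1 + \<delta>) * l"
      unfolding l_def using \<delta> by (intro sum_proj_vol_dir_le cL vs(2)) auto
    have 4: "?SK \<le> ?SL - \<epsilon> * ?SN"
    proof (induction vs)
      case (Cons v vs)
      then show ?case using dir[of v] by (simp add: algebra_simps)
    qed simp
    have "\<epsilon> / \<kappa>' * (?n * \<kappa> * root ?n (z / \<kappa>)) \<le> \<epsilon> / \<kappa>' * (2 * (\<kappa>' * ?SN))"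
      using 2 \<epsilon> \<kappa> by (intro mult_left_mono) auto
    also have "\<dots> = 2 * (\<epsilon> * ?SN)" using \<kappa> by simp
    finally have 5: "?n * (a * root ?n (z / a) + \<epsilon> / \<kappa>' * (\<kappa> * root ?n (z / \<kappa>))) \<le> ?n * ((1 + \<delta>) * l)"
      using 1 3 4 by (simp add: algebra_simps)
    have "(1 - \<delta>) * (a * root ?n (l / a) + \<epsilon> / \<kappa>' * (\<kappa> * root ?n (l / \<kappa>)))
        = a * ((1 - \<delta>) * root ?n (l / a)) + \<epsilon> / \<kappa>' * (\<kappa> * ((1 - \<delta>) * root ?n (l / \<kappa>)))"
      by (simp only: distrib_left mult.left_commute[of "1 - \<delta>"])
    also have "\<dots> \<le> a * root ?n (z / a) + \<epsilon> / \<kappa>' * (\<kappa> * root ?n (z / \<kappa>))"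
      using rz al \<kappa> \<epsilon> by (intro add_mono mult_left_mono) auto
    finally have "?n * ((1 - \<delta>) * (a * root ?n (l / a) + \<epsilon> / \<kappa>' * (\<kappa> * root ?n (l / \<kappa>))))
        \<le> ?n * (a * root ?n (z / a) + \<epsilon> / \<kappa>' * (\<kappa> * root ?n (z / \<kappa>)))"
      by (intro mult_left_mono) auto
    then show ?thesis using 5 by linarith
  qed
  let ?X = "a * root ?n (l / a) + \<epsilon> / \<kappa>' * (\<kappa> * root ?n (l / \<kappa>))"
  have "((\<lambda>\<delta>. (1 + \<delta>) * l - (1 - \<delta>) * ?X) \<longlongrightarrow> (1 + 0) * l - (1 - 0) * ?X) (at_right 0)"
    by (intro tendsto_intros)
  moreover have "\<forall>\<^sub>F \<delta> in at_right (0::real). 0 \<le> (1 + \<delta>) * l - (1 - \<delta>) * ?X"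
  proof -
    have "0 \<le> (1 + \<delta>) * l - (1 - \<delta>) * ?X" if "0 < \<delta>" "\<delta> < 1" for \<delta>
      using main[OF that] by (simp only: mult_le_cancel_left_pos of_nat_0_less_iff DIM_positive diff_ge_0_iff_ge)
    then show ?thesis by (auto simp: eventually_at_right_field intro!: exI[of _ 1])
  qed
  ultimately have "0 \<le> (1 + 0) * l - (1 - 0) * ?X" by (rule tendsto_lowerbound) simp
  then have X: "?X \<le> l" by simp
  have rl: "root ?n l > 0" using al by (simp add: real_root_gt_zero)
  \<comment> \<open>Factoring out |L|^(1/n) leaves |K|^((n-1)/n) + c_n \<epsilon>, with \<kappa> /
    \<open>root ?n \<kappa>\<close> divided by \<kappa>' being c_n.\<close>
  have "?X = (a / root ?n a + \<epsilon> / \<kappa>' * (\<kappa> / root ?n \<kappa>)) * root ?n l"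
    by (simp add: real_root_divide algebra_simps)
  then have "a / root ?n a + \<epsilon> / \<kappa>' * (\<kappa> / root ?n \<kappa>) \<le> l / root ?n l"
    using X rl by (simp add: pos_le_divide_eq)
  then show ?thesis
    unfolding divide_root_eq_powr[OF al(1) DIM_positive] divide_root_eq_powr[OF al(2) DIM_positive]
      divide_root_eq_powr[OF \<kappa>(1) DIM_positive]
    by (simp add: proj_const_def a_def l_def \<kappa>_def \<kappa>'_def mult.commute)
qed

theorem theorem1:
  fixes K L :: "(real ^ 'n) set" and \<epsilon> :: real
  assumes "CARD('n) \<ge> 2"
    and "\<epsilon> > 0"
    and "convex_body K" and "origin_symmetric K"
    and "convex_body L" and "origin_symmetric L"
    and "projection_body L"
    and "\<And>\<xi>. \<xi> \<in> sphere 0 1 \<Longrightarrow> proj_vol K \<xi> \<le> proj_vol L \<xi> - \<epsilon>"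
  shows "measure lebesgue K powr ((real CARD('n) - 1) / real CARD('n))
       \<le> measure lebesgue L powr ((real CARD('n) - 1) / real CARD('n))
          - proj_const CARD('n) * \<epsilon>"
  using shephard_stability[OF assms(2-4,7)] assms(8) by simp

end
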